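(* Let $\lambda$ be a partition and let $\mathcal M(\lambda)$ be the set of super fillings of the Young diagram $\mathsf{dg}(\lambda)$. Then, as formal power series in $X$, $$\sum_{\substack{\sigma\in\mathcal M(\lambda)\\ |\sigma|\ \text{non-attacking}}}(-1)^{m(\sigma)}q^{\mathsf{maj}(\sigma)}t^{p(\sigma)+\mathsf{quadcoinv}(\sigma)}x^{|\sigma|} =\sum_{\substack{\sigma\in\mathcal M(\lambda)\\ |\sigma|\ \mathsf{quinv}\text{-non-attacking}}}(-1)^{m(\sigma)}q^{\mathsf{maj}(\sigma)}t^{p(\sigma)+\mathsf{quinv}(\sigma)}x^{|\sigma|}.$$
   Context: $\mathsf{dg}(\lambda)$ has boxes $(i,j)$ with $1\le j$, $1\le i\le h_j$ where $h_j=\lambda'_j$ is the height of column $j$ (rows counted from the bottom, columns from the left; $\lambda'$ the conjugate). $\mathsf{South}(u)$ is the box directly below $u$; $\mathsf{leg}(u)$ the number of boxes strictly above $u$ in its column. Let $\mathcal A=\{1,\bar1,2,\bar2,\dots\}$ with total order $0<1<\bar1<2<\bar2<\cdots<\infty$ on $\mathcal A\cup\{0,\infty\}$; $|i|=|\bar i|=i$, $|0|=0$, $|\infty|=\infty$; $\mathbb Z_+=\{1,2,\dots\}$, $\mathbb Z_-=\{\bar1,\bar2,\dots\}$. A super filling is a map $\sigma:\mathsf{dg}(\lambda)\to\mathcal A$; $p(\sigma),m(\sigma)$ are the numbers of positive and negative entries; $|\sigma|$ takes absolute values entrywise; $x^{|\sigma|}=\prod_z x_{|\sigma(z)|}$.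 The augmented filling $\hat\sigma$ has in addition entry $0$ at $(h_j+1,j)$ and $\infty$ at $(0,j)$ for each column $j$. For $a,b\in\mathcal A\cup\{0,\infty\}$: $I(a,b)=1$ if $a>b$ or $a=b\in\mathbb Z_-$, else $0$. $\mathcal Q(a,b,c)=1$ iff exactly one of $I(a,b)=1$, $I(c,b)=0$, $I(a,c)=0$ holds. $\mathsf{maj}(\sigma)=\sum(\mathsf{leg}(z)+1)$ over boxes $z$ not in row 1 with $I(\sigma(z),\sigma(\mathsf{South}(z)))=1$. A queue inversion triple is a triple $(a,b,c)$ of entries of $\hat\sigma$ with $a$ at $(r+1,j)$, $b$ at $(r,j)$, $c$ at $(r,k)$, $k>j$, $c\ne0$, $\mathcal Q(a,b,c)=1$; $\mathsf{quinv}(\sigma)$ is their number. For values $z,w,u,v$ define $\mathcal Q(z,w,u,v)$: (1) if $|w|=|v|$ and $|z|,|u|,|w|$ are pairwise distinct, $\mathcal Q(z,w,u,v)=1$ iff $w\in\mathbb Z_+$; (2) if $|w|=|u|$, $|z|\ne|w|$, $|v|\ne|w|$, then $\mathcal Q(z,w,u,v)=1$ iff $w\in\mathbb Z_-$; otherwise $\mathcal Q(z,w,u,v)=\mathcal Q(z,u,v)$. $\mathsf{quadcoinv}(\sigma)$ is the number of quadruples of entries $z$ at $(r+1,j)$, $w$ at $(r+1,k)$, $u$ at $(r,j)$, $v$ at $(r,k)$ of $\hat\sigma$ with $j<k$, $h_j=h_k$ and $\mathcal Q(z,w,u,v)=1$, plus the number of queue inversion triples $(a,b,c)$ in which the column of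 $a,b$ is strictly taller than the column of $c$. A positive filling $\tau$ is $\mathsf{quinv}$-non-attacking if there are no two distinct boxes $u,v$ with $\tau(u)=\tau(v)$ such that (I) $u,v$ are in the same row, or (II) $u=(i+1,j)$, $v=(i,k)$ with $k>j$. It is non-attacking if moreover there are no such $u,v$ with (III) $u=(i,j)$, $v=(i-1,k)$, $k<j$, $h_j=h_k$. *)

theory Defs
  imports
    "HOL-Library.FuncSet"
    "HOL-Library.Extended_Nat"
    "HOL-Library.Multiset"
    "HOL-Computational_Algebra.Polynomial"
begin

section \<open>Partitions and diagrams\<close>

definition is_partition :: "nat list \<Rightarrow> bool" where
  "is_partition lam \<longleftrightarrow> sorted_wrt (\<ge>) lam \<and> 0 \<notin> set lam"

text \<open>The height of column \<open>j\<close> is the conjugate part \<open>\<lambda>'\<^sub>j\<close>, the number of parts that are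
  at least \<open>j\<close>. A box \<open>(i, j)\<close> lies in row \<open>i\<close> (from the bottom) and column \<open>j\<close>, both counted
  from 1.\<close>

definition colht :: "nat list \<Rightarrow> nat \<Rightarrow> nat" where
  "colht lam j = card {i. i < length lam \<and> j \<le> lam ! i}"

definition dg :: "nat list \<Rightarrow> (nat \<times> nat) set" where
  "dg lam = {(i, j). 1 \<le> j \<and> 1 \<le> i \<and> i \<le> colht lam j}"

fun South :: "nat \<times> nat \<Rightarrow> nat \<times> nat" where
  "South (i, j) = (i - 1, j)"

fun leg :: "nat list \<Rightarrow> nat \<times> nat \<Rightarrow> nat" where
  "leg lam (i, j) = card {i'. i < i' \<and> (i', j) \<in> dg lam}"


section \<open>The super alphabet\<close>

text \<open>\<open>Pos i\<close> and \<open>Neg i\<close> stand for \<open>i\<close> and \<open>i\<close> barred; the alphabet consists of those with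
  \<open>i \<ge> 1\<close>. The type \<open>entry\<close> adds the two extra symbols \<open>0\<close> and \<open>\<infinity>\<close> of augmented fillings.\<close>

datatype letter = Pos nat | Neg nat

datatype entry = Zero | Letter letter | Infty

fun labs :: "letter \<Rightarrow> nat" where
  "labs (Pos i) = i"
| "labs (Neg i) = i"

fun is_neg :: "letter \<Rightarrow> bool" where
  "is_neg (Pos i) \<longleftrightarrow> False"
| "is_neg (Neg i) \<longleftrightarrow> True"

definition alphabet :: "letter set" where
  "alphabet = {a. 1 \<le> labs a}"

fun eabs :: "entry \<Rightarrow> enat" where
  "eabs Zero = 0"
| "eabs (Letter a) = enat (labs a)"
| "eabs Infty = \<infinity>"

definition Zplus :: "entry set" where
  "Zplus = {Letter a | a. a \<in> alphabet \<and> \<not> is_neg a}"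

definition Zminus :: "entry set" where
  "Zminus = {Letter a | a. a \<in> alphabet \<and> is_neg a}"

text \<open>The rank realises the order \<open>0 < 1 < 1bar < 2 < 2bar < \<dots> < \<infinity>\<close>. The shift makes it
  injective on the whole type, so that the order is linear there as well; the letters with
  index 0, which are not in the alphabet, sit directly above \<open>0\<close>.\<close>

fun rank :: "entry \<Rightarrow> enat" where
  "rank Zero = 0"
| "rank (Letter (Pos i)) = enat (2 * i + 1)"
| "rank (Letter (Neg i)) = enat (2 * i + 2)"
| "rank Infty = \<infinity>"

lemma rank_inject: "rank a = rank b \<longleftrightarrow> a = b"
proof
  assume "rank a = rank b"
  then show "a = b"
    by (cases a rule: rank.cases; cases b rule: rank.cases) (auto simp: zero_enat_def, presburger+)
qed simp

instantiation entry :: linorder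
begin

definition less_eq_entry :: "entry \<Rightarrow> entry \<Rightarrow> bool" where
  "a \<le> b \<longleftrightarrow> rank a \<le> rank b"

definition less_entry :: "entry \<Rightarrow> entry \<Rightarrow> bool" where
  "a < b \<longleftrightarrow> rank a < rank b"

instance
  by standard (auto simp: less_eq_entry_def less_entry_def rank_inject[symmetric])

end

definition cmpI :: "entry \<Rightarrow> entry \<Rightarrow> bool" where
  "cmpI a b \<longleftrightarrow> a > b \<or> (a = b \<and> b \<in> Zminus)"

text \<open>Exactly one of the three conditions \<open>I(a,b) = 1\<close>, \<open>I(c,b) = 0\<close>, \<open>I(a,c) = 0\<close> holds.\<close>

definition Q3 :: "entry \<Rightarrow> entry \<Rightarrow> entry \<Rightarrow> bool" where
  "Q3 a b c \<longleftrightarrow>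
     of_bool (cmpI a b) + of_bool (\<not> cmpI c b) + of_bool (\<not> cmpI a c) = (1::nat)"

definition Q4 :: "entry \<Rightarrow> entry \<Rightarrow> entry \<Rightarrow> entry \<Rightarrow> bool" where
  "Q4 z w u v \<longleftrightarrow>
     (if eabs w = eabs v \<and> eabs z \<noteq> eabs u \<and> eabs z \<noteq> eabs w \<and> eabs u \<noteq> eabs w
      then w \<in> Zplus
      else if eabs w = eabs u \<and> eabs z \<noteq> eabs w \<and> eabs v \<noteq> eabs w
      then w \<in> Zminus
      else Q3 z u v)"


section \<open>Super fillings and their statistics\<close>

definition super_fillings :: "nat list \<Rightarrow> (nat \<times> nat \<Rightarrow> letter) set" where
  "super_fillings lam = dg lam \<rightarrow>\<^sub>E alphabet"

definition num_pos :: "nat list \<Rightarrow> (nat \<times> nat \<Rightarrow> letter) \<Rightarrow> nat" where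
  "num_pos lam \<sigma> = card {z \<in> dg lam. \<not> is_neg (\<sigma> z)}"

definition num_neg :: "nat list \<Rightarrow> (nat \<times> nat \<Rightarrow> letter) \<Rightarrow> nat" where
  "num_neg lam \<sigma> = card {z \<in> dg lam. is_neg (\<sigma> z)}"

definition abs_filling :: "(nat \<times> nat \<Rightarrow> letter) \<Rightarrow> nat \<times> nat \<Rightarrow> nat" where
  "abs_filling \<sigma> = (\<lambda>z. labs (\<sigma> z))"

definition augdg :: "nat list \<Rightarrow> (nat \<times> nat) set" where
  "augdg lam = {(i, j). 1 \<le> j \<and> 1 \<le> colht lam j \<and> i \<le> colht lam j + 1}"

text \<open>The augmented filling; only its values on \<^const>\<open>augdg\<close> are meaningful.\<close>

fun aug :: "nat list \<Rightarrow> (nat \<times> nat \<Rightarrow> letter) \<Rightarrow> nat \<times> nat \<Rightarrow> entry" where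
  "aug lam \<sigma> (i, j) =
     (if i = 0 then Infty else if i = colht lam j + 1 then Zero else Letter (\<sigma> (i, j)))"

definition maj :: "nat list \<Rightarrow> (nat \<times> nat \<Rightarrow> letter) \<Rightarrow> nat" where
  "maj lam \<sigma> =
     (\<Sum>z | z \<in> dg lam \<and> fst z \<noteq> 1 \<and> cmpI (Letter (\<sigma> z)) (Letter (\<sigma> (South z))). leg lam z + 1)"

text \<open>A triple \<open>(a, b, c)\<close> is recorded by \<open>(r, j, k)\<close>: \<open>a\<close> at \<open>(r+1, j)\<close>, \<open>b\<close> at \<open>(r, j)\<close> and
  \<open>c\<close> at \<open>(r, k)\<close>. Likewise for quadruples.\<close>

definition quinv_triples ::
    "nat list \<Rightarrow> (nat \<times> nat \<Rightarrow> letter) \<Rightarrow> (nat \<times> nat \<times> nat) set" where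
  "quinv_triples lam \<sigma> = {(r, j, k).
     (r + 1, j) \<in> augdg lam \<and> (r, j) \<in> augdg lam \<and> (r, k) \<in> augdg lam \<and> j < k \<and>
     aug lam \<sigma> (r, k) \<noteq> Zero \<and>
     Q3 (aug lam \<sigma> (r + 1, j)) (aug lam \<sigma> (r, j)) (aug lam \<sigma> (r, k))}"

definition quinv :: "nat list \<Rightarrow> (nat \<times> nat \<Rightarrow> letter) \<Rightarrow> nat" where
  "quinv lam \<sigma> = card (quinv_triples lam \<sigma>)"

definition quadcoinv_quadruples ::
    "nat list \<Rightarrow> (nat \<times> nat \<Rightarrow> letter) \<Rightarrow> (nat \<times> nat \<times> nat) set" where
  "quadcoinv_quadruples lam \<sigma> = {(r, j, k).
     (r + 1, j) \<in> augdg lam \<and> (r + 1, k) \<in> augdg lam \<and>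
     (r, j) \<in> augdg lam \<and> (r, k) \<in> augdg lam \<and>
     j < k \<and> colht lam j = colht lam k \<and>
     Q4 (aug lam \<sigma> (r + 1, j)) (aug lam \<sigma> (r + 1, k)) (aug lam \<sigma> (r, j)) (aug lam \<sigma> (r, k))}"

definition quadcoinv :: "nat list \<Rightarrow> (nat \<times> nat \<Rightarrow> letter) \<Rightarrow> nat" where
  "quadcoinv lam \<sigma> =
     card (quadcoinv_quadruples lam \<sigma>) +
     card {(r, j, k) \<in> quinv_triples lam \<sigma>. colht lam j > colht lam k}"


section \<open>Non-attacking fillings\<close>

definition quinv_non_attacking :: "nat list \<Rightarrow> (nat \<times> nat \<Rightarrow> nat) \<Rightarrow> bool" where
  "quinv_non_attacking lam \<tau> \<longleftrightarrow>
     \<not> (\<exists>u\<in>dg lam. \<exists>v\<in>dg lam. u \<noteq> v \<and> \<tau> u = \<tau> v \<and>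
          (fst u = fst v \<or> (fst u = fst v + 1 \<and> snd v > snd u)))"

definition non_attacking :: "nat list \<Rightarrow> (nat \<times> nat \<Rightarrow> nat) \<Rightarrow> bool" where
  "non_attacking lam \<tau> \<longleftrightarrow> quinv_non_attacking lam \<tau> \<and>
     \<not> (\<exists>u\<in>dg lam. \<exists>v\<in>dg lam. u \<noteq> v \<and> \<tau> u = \<tau> v \<and>
          fst u = fst v + 1 \<and> snd v < snd u \<and> colht lam (snd u) = colht lam (snd v))"


section \<open>Formal power series in infinitely many variables\<close>

text \<open>A monomial in the variables \<open>x\<^sub>1, x\<^sub>2, \<dots>\<close> is the finite multiset of the indices of its
  variables, and a formal power series is its coefficient function. The coefficient ring is
  \<open>\<int>[t][q]\<close>.\<close>

type_synonym monomial = "nat multiset"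
type_synonym 'a power_series = "monomial \<Rightarrow> 'a"

definition qvar :: "int poly poly" where
  "qvar = [:0, 1:]"

definition tvar :: "int poly poly" where
  "tvar = [:[:0, 1:]:]"

text \<open>\<open>\<Prod>z. x\<^bsub>\<tau>(z)\<^esub>\<close> over all boxes \<open>z\<close>.\<close>

definition xmonom :: "nat list \<Rightarrow> (nat \<times> nat \<Rightarrow> nat) \<Rightarrow> monomial" where
  "xmonom lam \<tau> = image_mset \<tau> (mset_set (dg lam))"

text \<open>The series \<open>\<Sum>s\<in>S. c s \<sqdot> x\<^bsup>m s\<^esup>\<close>, defined when every monomial occurs for only finitely
  many \<open>s\<close>; the lemma at the end of this theory shows this for super fillings.\<close>

definition series_sum :: "'s set \<Rightarrow> ('s \<Rightarrow> 'a::comm_monoid_add) \<Rightarrow> ('s \<Rightarrow> monomial) \<Rightarrow> 'a power_series"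
  where "series_sum S c m = (\<lambda>\<mu>. \<Sum>s | s \<in> S \<and> m s = \<mu>. c s)"

lemma finite_dg: "finite (dg lam)"
proof (rule finite_subset)
  show "dg lam \<subseteq> {..length lam} \<times> {..Max (insert 0 (set lam))}"
  proof
    fix z assume "z \<in> dg lam"
    then obtain i j where z: "z = (i, j)" and ij: "1 \<le> i" "i \<le> colht lam j"
      by (auto simp: dg_def)
    have "colht lam j \<le> card {..<length lam}"
      unfolding colht_def by (intro card_mono) auto
    with ij have i: "i \<le> length lam" by simp
    have "{i. i < length lam \<and> j \<le> lam ! i} \<noteq> {}"
      using ij unfolding colht_def by force
    then obtain k where "k < length lam" "j \<le> lam ! k" by auto
    then have "j \<le> Max (insert 0 (set lam))"
      by (meson List.finite_set Max_ge finite.insertI insertCI nth_mem order_trans)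
    with i z show "z \<in> {..length lam} \<times> {..Max (insert 0 (set lam))}" by simp
  qed
qed simp

lemma finite_fillings_of_monomial:
  "finite {\<sigma> \<in> super_fillings lam. xmonom lam (abs_filling \<sigma>) = \<mu>}"
proof (rule finite_subset)
  let ?A = "Pos ` set_mset \<mu> \<union> Neg ` set_mset \<mu>"
  show "{\<sigma> \<in> super_fillings lam. xmonom lam (abs_filling \<sigma>) = \<mu>} \<subseteq> dg lam \<rightarrow>\<^sub>E ?A"
  proof
    fix \<sigma> assume "\<sigma> \<in> {\<sigma> \<in> super_fillings lam. xmonom lam (abs_filling \<sigma>) = \<mu>}"
    then have ext: "\<sigma> \<in> extensional (dg lam)" and mu: "\<mu> = xmonom lam (abs_filling \<sigma>)"
      by (auto simp: super_fillings_def PiE_def)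
    have *: "set_mset \<mu> = (\<lambda>z. labs (\<sigma> z)) ` dg lam"
      by (simp add: mu xmonom_def abs_filling_def finite_dg)
    have "\<sigma> z \<in> ?A" if "z \<in> dg lam" for z
    proof -
      have "labs (\<sigma> z) \<in> set_mset \<mu>" using * that by blast
      then show ?thesis by (cases "\<sigma> z") auto
    qed
    with ext show "\<sigma> \<in> dg lam \<rightarrow>\<^sub>E ?A" by (auto simp: PiE_def)
  qed
  show "finite (dg lam \<rightarrow>\<^sub>E ?A)" by (intro finite_PiE finite_dg) auto
qed

end

theory Submission
  imports Defs "HOL-Combinatorics.Transposition"
begin

text \<open>
  Fix the absolute values \<open>\<tau>\<close> and sum over the signs. If \<open>\<tau>\<close> is non-attacking, the sign of a box
  matters only when the box has the same absolute value as its southern neighbour, so the sum is a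
  product over boxes, and hence a product over pairs of consecutive rows. Let \<open>z\<close> be the upper and
  \<open>u\<close> the lower row of such a pair.

  For \<open>quinv\<close>, an identity for two adjacent columns of equal height says that the weight summed over
  the two orders of their entries in \<open>u\<close> does not change when their entries in \<open>z\<close> are swapped. Going
  up row by row, the sum over everything below a given row is therefore symmetric in the entries of
  that row lying in columns of equal height. So one may move to the left those entries of \<open>z\<close> that
  also occur in \<open>u\<close> within columns of the same height. For \<open>z\<close> sorted in this way the
  \<open>quinv\<close>-non-attacking condition puts equal entries into the same column; then the conditions of type
  III hold and the factors for \<open>quinv\<close> and \<open>quadcoinv\<close> coincide. The factor for \<open>quadcoinv\<close> does not
  change when \<open>z\<close> and \<open>u\<close> are sorted simultaneously, so the two sums agree.
\<close>

section \<open>Pairs of columns\<close>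

text \<open>This is \<^const>\<open>Q3\<close> for entries with distinct absolute values.\<close>

definition cyc :: "nat \<Rightarrow> nat \<Rightarrow> nat \<Rightarrow> bool" where
  "cyc z a b \<longleftrightarrow> of_bool (a < z) + of_bool (b < a) + of_bool (z \<le> b) = (1::nat)"

text \<open>For distinct entries \<open>cyc z a b\<close> says that z, a, b increase cyclically. Of
  the three conditions in \<open>cyc\<close> one or two hold, never none or all, so the indicator is
  2 minus their number, which is linear in comparisons of two entries.\<close>

lemma of_bool_cyc:
  assumes "z \<noteq> a" "z \<noteq> b" "a \<noteq> b"
  shows "(of_bool (cyc z a b) :: int) =
    1 - of_bool (a < z) - of_bool (b < a) + of_bool (b < z)"
  using assms by (auto simp: cyc_def of_bool_def)

lemma cyc_flip:
  assumes "z \<noteq> a" "z \<noteq> b" "a \<noteq> b"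
  shows "cyc z b a \<longleftrightarrow> \<not> cyc z a b"
  using assms by (auto simp: cyc_def)

definition ncyc :: "nat set \<Rightarrow> nat \<Rightarrow> nat \<Rightarrow> nat" where
  "ncyc C z u = card {c \<in> C. cyc z u c}"

text \<open>Summing the linear form of \<open>cyc\<close> over \<open>C\<close> separates the
  entries: apart from the descent \<open>u < z\<close>, the count is a function of z minus the same
  function of u. Exponents for different pairings of the same entries can thus be compared through
  their descents.\<close>

lemma int_ncyc:
  assumes "finite C" "z \<notin> C" "u \<notin> C" "z \<noteq> u"
  shows "int (ncyc C z u) = int (card C) * (1 - of_bool (u < z))
           + (\<Sum>c\<in>C. of_bool (c < z)) - (\<Sum>c\<in>C. of_bool (c < u))"
proof -
  have "int (ncyc C z u) = (\<Sum>c\<in>C. of_bool (cyc z u c))"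
    using assms(1) by (simp add: ncyc_def Int_def flip: sum.inter_filter)
  also have "\<dots> = (\<Sum>c\<in>C. 1 - of_bool (u < z) + of_bool (c < z) - of_bool (c < u))"
  proof (intro sum.cong refl)
    fix c assume "c \<in> C"
    with assms have "c \<noteq> z" "c \<noteq> u" by auto
    with assms(4) show "(of_bool (cyc z u c) :: int) =
        1 - of_bool (u < z) + of_bool (c < z) - of_bool (c < u)"
      by (simp add: of_bool_cyc)
  qed
  also have "\<dots> = int (card C) * (1 - of_bool (u < z))
           + (\<Sum>c\<in>C. of_bool (c < z)) - (\<Sum>c\<in>C. of_bool (c < u))"
    by (simp add: sum.distrib sum_subtractf algebra_simps)
  finally show ?thesis .
qed

lemma ncyc_insert:
  assumes "finite C" "b \<notin> C"
  shows "ncyc (insert b C) z a = ncyc C z a + of_bool (cyc z a b)"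
proof -
  have "{c \<in> insert b C. cyc z a c} =
      (if cyc z a b then insert b {c \<in> C. cyc z a c} else {c \<in> C. cyc z a c})"
    by auto
  with assms show ?thesis by (simp add: ncyc_def)
qed

lemma ncyc_image:
  assumes "inj_on f A"
  shows "ncyc (f ` A) z u = card {k \<in> A. cyc z u (f k)}"
proof -
  have "{c \<in> f ` A. cyc z u c} = f ` {k \<in> A. cyc z u (f k)}" by auto
  then show ?thesis by (simp add: ncyc_def card_image inj_on_subset[OF assms])
qed

text \<open>The sign sum over a box with absolute value \<open>z\<close> above one with absolute value \<open>u\<close>; \<open>C\<close> holds the
  absolute values to the right of \<open>u\<close> in its row, and \<open>e\<close> is the contribution of a descent to
  \<^const>\<open>maj\<close>.\<close>

definition colfac :: "nat \<Rightarrow> nat set \<Rightarrow> nat \<Rightarrow> nat \<Rightarrow> int poly poly" where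
  "colfac e C z u =
     (if z = u then tvar ^ Suc (card C) - qvar ^ e
      else (tvar - 1) * qvar ^ (e * of_bool (u < z)) * tvar ^ ncyc C z u)"

text \<open>The columns are \<open>z\<close> over \<open>u\<close> and, to their right, \<open>w\<close> over \<open>v\<close>; the case \<open>z = v\<close> is attacking.\<close>

definition colpair :: "nat \<Rightarrow> nat set \<Rightarrow> nat \<Rightarrow> nat \<Rightarrow> nat \<Rightarrow> nat \<Rightarrow> int poly poly" where
  "colpair e C z w u v =
     (if z = v then 0 else colfac e (insert v C) z u * colfac e C w v)"

text \<open>Here the upper left entry stands on itself; the fourth term of the exchange,
  \<open>colpair e C z w v z\<close>, is attacking and vanishes. With c = card C and common factors
  removed, t^(c+2) - q^e is split as (t-1) t^(c+1) + (t^(c+1) - q^e) if \<open>cyc w z v\<close>,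
  and as (t-1) q^e + t (t^(c+1) - q^e) otherwise.\<close>

lemma colpair_exchange_hit:
  assumes C: "finite C" "z \<notin> C" "w \<notin> C" "v \<notin> C" and ne: "z \<noteq> w" "z \<noteq> v" "w \<noteq> v"
  shows "colpair e C z w z v = colpair e C w z z v + colpair e C w z v z"
proof -
  \<comment> \<open>In \<open>int_ncyc\<close> the contributions of z telescope along w, z, v; what
    is left over is a comparison of descents, which \<open>of_bool_cyc\<close> identifies with
    \<open>cyc w z v\<close>.\<close>
  have N: "ncyc C w z + ncyc C z v = ncyc C w v + card C * of_bool (cyc w z v)"
  proof -
    have "int (ncyc C w z) + int (ncyc C z v) = int (ncyc C w v) +
        int (card C) * (1 - of_bool (z < w) - of_bool (v < z) + of_bool (v < w))"
      using C ne by (simp add: int_ncyc algebra_simps)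
    also have "(1 - of_bool (z < w) - of_bool (v < z) + of_bool (v < w) :: int) =
        of_bool (cyc w z v)"
      using of_bool_cyc[of w z v] ne by linarith
    finally have "int (ncyc C w z + ncyc C z v) = int (ncyc C w v + card C * of_bool (cyc w z v))"
      by simp
    then show ?thesis by (simp only: of_nat_eq_iff)
  qed
  have D: "(of_bool (z < w) + of_bool (v < z) :: nat) = of_bool (v < w) + of_bool (\<not> cyc w z v)"
    using ne by (auto simp: cyc_def)
  have C': "cyc w v z \<longleftrightarrow> \<not> cyc w z v"
    using cyc_flip[of w z v] ne by blast
  define d1 d2 d3 where "d1 = (of_bool (z < w) :: nat)" "d2 = (of_bool (v < z) :: nat)"
    "d3 = (of_bool (v < w) :: nat)"
  note d = d1_d2_d3_def[symmetric]
  \<comment> \<open>Compared with w over v alone, passing through z costs t^(card C) or q^e,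
    according to the cyclic order.\<close>
  have key: "qvar ^ (e * d1) * tvar ^ ncyc C w z * (qvar ^ (e * d2) * tvar ^ ncyc C z v) =
     qvar ^ (e * d3) * tvar ^ ncyc C w v *
       (if cyc w z v then tvar ^ card C else qvar ^ e)"
  proof -
    have "qvar ^ (e * d1) * tvar ^ ncyc C w z * (qvar ^ (e * d2) * tvar ^ ncyc C z v) =
        qvar ^ (e * (d1 + d2)) * tvar ^ (ncyc C w z + ncyc C z v)"
      by (simp add: power_add algebra_simps)
    also have "\<dots> = qvar ^ (e * (d3 + of_bool (\<not> cyc w z v))) *
        tvar ^ (ncyc C w v + card C * of_bool (cyc w z v))"
      using N D unfolding d by simp
    finally show ?thesis by (simp add: power_add)
  qed
  show ?thesis
    using key ne C C' unfolding colpair_def colfac_def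
    by (cases "cyc w z v") (simp_all add: ncyc_insert d, simp_all add: algebra_simps)
qed

text \<open>All four weights are (t-1)^2 times a monomial, and both sides consist of the same two
  monomials. If z and w see u, v in the same orientation, the terms with the same lower row agree;
  otherwise those in which both rows are exchanged agree.\<close>

lemma colpair_exchange_disjoint:
  assumes C: "finite C" "{z, w, u, v} \<inter> C = {}"
    and ne: "z \<noteq> w" "u \<noteq> v" "z \<noteq> u" "z \<noteq> v" "w \<noteq> u" "w \<noteq> v"
  shows "colpair e C z w u v + colpair e C z w v u = colpair e C w z u v + colpair e C w z v u"
proof -
  have D: "of_bool (cyc z u v) + of_bool (u < z) + of_bool (v < w) =
     (of_bool (cyc w u v) + of_bool (v < z) + of_bool (u < w) :: int)"
    using of_bool_cyc[of z u v] of_bool_cyc[of w u v] ne by linarith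
  have N: "int (ncyc C z u + ncyc C w v) - int (ncyc C z v + ncyc C w u) =
     int (card C) * ((of_bool (v < z) + of_bool (u < w)) - (of_bool (u < z) + of_bool (v < w)))"
    using int_ncyc[of C z u] int_ncyc[of C w v] int_ncyc[of C z v] int_ncyc[of C w u] C ne
    by (simp add: algebra_simps)
  have C': "cyc w v u \<longleftrightarrow> \<not> cyc w u v" "cyc z v u \<longleftrightarrow> \<not> cyc z u v"
    using cyc_flip[of w u v] cyc_flip[of z u v] ne by blast+
  define d1 d2 d3 d4 where d: "d1 = (of_bool (u < z) :: nat)" "d2 = (of_bool (v < w) :: nat)"
    "d3 = (of_bool (v < z) :: nat)" "d4 = (of_bool (u < w) :: nat)"
  have mono: "colpair e C x y a b = (tvar - 1)^2 * qvar ^ (e * (of_bool (a < x) + of_bool (b < y)))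
     * tvar ^ (ncyc C x a + ncyc C y b + of_bool (cyc x a b))"
    if "x \<noteq> b" "x \<noteq> a" "y \<noteq> b" "b \<notin> C" for x y a b
    using that C(1) by (simp add: colpair_def colfac_def ncyc_insert power_add power2_eq_square
        algebra_simps)
  have pairs:
    "colpair e C w z u v = (tvar - 1)^2 * qvar ^ (e * (d4 + d3))
       * tvar ^ (ncyc C w u + ncyc C z v + of_bool (cyc w u v))"
    "colpair e C z w u v = (tvar - 1)^2 * qvar ^ (e * (d1 + d2))
       * tvar ^ (ncyc C z u + ncyc C w v + of_bool (cyc z u v))"
    "colpair e C w z v u = (tvar - 1)^2 * qvar ^ (e * (d2 + d1))
       * tvar ^ (ncyc C w v + ncyc C z u + of_bool (cyc w v u))"
    "colpair e C z w v u = (tvar - 1)^2 * qvar ^ (e * (d3 + d4))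
       * tvar ^ (ncyc C z v + ncyc C w u + of_bool (cyc z v u))"
    unfolding d using ne C by (subst mono; simp)+
  show ?thesis
  proof (cases "cyc z u v = cyc w u v")
    case True
    \<comment> \<open>Equal orientations force equally many descents in the two pairings, and by
      \<open>N\<close> then equal counts over \<open>C\<close>.\<close>
    then have "d1 + d2 = d3 + d4" using D unfolding d by (simp split: if_splits add: of_bool_def)
    moreover have "ncyc C z u + ncyc C w v = ncyc C z v + ncyc C w u"
      using N D True by simp
    ultimately show ?thesis using True C' by (simp add: pairs add.commute)
  next
    case False
    then have "cyc w v u = cyc z u v" "cyc z v u = cyc w u v" using C' by auto
    then show ?thesis by (simp add: pairs add.commute)
  qed
qed

text \<open>Each upper entry that recurs below makes one of the four terms attacking, hence 0. No
  recurrence leaves four monomials, one leaves the three-term identity, and two leave one product of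
  diagonal factors on each side, which depends only on \<open>e\<close> and the size of
  \<open>C\<close>.\<close>

lemma colpair_exchange:
  assumes C: "finite C" "{z, w, u, v} \<inter> C = {}" and ne: "z \<noteq> w" "u \<noteq> v"
  shows "colpair e C z w u v + colpair e C z w v u = colpair e C w z u v + colpair e C w z v u"
proof -
  have zero: "colpair e C a x y a = 0" for a x y by (simp add: colpair_def)
  consider "{z, w} \<inter> {u, v} = {}" | "{z, w} = {u, v}"
    | "z = u" "w \<noteq> v" | "z = v" "w \<noteq> u" | "w = u" "z \<noteq> v" | "w = v" "z \<noteq> u"
    using ne by blast
  then show ?thesis
  proof cases
    case 1
    then show ?thesis using C ne by (intro colpair_exchange_disjoint) auto
  next
    case 2
    then have "z = u \<and> w = v \<or> z = v \<and> w = u" using ne by (auto simp: doubleton_eq_iff)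
    then show ?thesis
      using C ne by (auto simp: zero colpair_def colfac_def algebra_simps)
  next
    case 3
    then show ?thesis
      using C ne colpair_exchange_hit[of C z w v e] by (auto simp: zero)
  next
    case 4
    then show ?thesis
      using C ne colpair_exchange_hit[of C z w u e] by (auto simp: zero)
  next
    case 5
    then show ?thesis
      using C ne colpair_exchange_hit[of C w z v e] by (auto simp: zero)
  next
    case 6
    then show ?thesis
      using C ne colpair_exchange_hit[of C w z u e] by (auto simp: zero)
  qed
qed

section \<open>Rearranging columns of equal height\<close>

lemma colht_antimono: "j \<le> k \<Longrightarrow> colht lam k \<le> colht lam j"
  unfolding colht_def by (rule card_mono) auto

context
  fixes lam :: "nat list"
begin

abbreviation (input) ht :: "nat \<Rightarrow> nat" where
  "ht \<equiv> colht lam"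

definition right :: "nat \<Rightarrow> nat \<Rightarrow> nat set" where
  "right r j = {k. j < k \<and> r \<le> ht k}"

text \<open>Indexed by the lower row: these columns have a box in row \<open>Suc r\<close>. In
  particular \<open>cols 0\<close> consists of all nonempty columns.\<close>

definition cols :: "nat \<Rightarrow> nat set" where
  "cols r = {j. 1 \<le> j \<and> r < ht j}"

definition lev_quinv_na :: "nat \<Rightarrow> (nat \<times> nat \<Rightarrow> nat) \<Rightarrow> bool" where
  "lev_quinv_na r \<tau> \<longleftrightarrow> (\<forall>j k. 1 \<le> j \<and> j < k \<and> r < ht j \<and> r \<le> ht k \<longrightarrow> \<tau> (Suc r, j) \<noteq> \<tau> (r, k))"

text \<open>The bound \<open>ht k \<le> ht j\<close> merges attacks of types II and III: for
  \<open>j < k\<close> it is automatic, and for \<open>k < j\<close> it forces equal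
  heights.\<close>

definition lev_quad_na :: "nat \<Rightarrow> (nat \<times> nat \<Rightarrow> nat) \<Rightarrow> bool" where
  "lev_quad_na r \<tau> \<longleftrightarrow> (\<forall>j k. 1 \<le> j \<and> 1 \<le> k \<and> j \<noteq> k \<and> r < ht j \<and> r \<le> ht k \<and> ht k \<le> ht j
     \<longrightarrow> \<tau> (Suc r, j) \<noteq> \<tau> (r, k))"

text \<open>The factor belongs to the box \<open>(Suc r, j)\<close>, whose leg plus one is
  \<open>ht j - r\<close>. Attacking pairs of rows get weight 0, so that sums can run over a set of
  fillings closed under swaps.\<close>

definition wt_quinv :: "nat \<Rightarrow> (nat \<times> nat \<Rightarrow> nat) \<Rightarrow> int poly poly" where
  "wt_quinv r \<tau> = (if lev_quinv_na r \<tau> then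
     (\<Prod>j\<in>cols r. colfac (ht j - r) ((\<lambda>k. \<tau> (r, k)) ` right r j) (\<tau> (Suc r, j)) (\<tau> (r, j))) else 0)"

text \<open>The quadruples falling under case (1) of \<^const>\<open>Q4\<close> depend on the sign of the upper right
  entry \<open>w\<close>; they are charged to the box of \<open>w\<close> and excluded from the count at the box of \<open>z\<close>.\<close>

definition fac_quad :: "nat \<Rightarrow> (nat \<times> nat \<Rightarrow> nat) \<Rightarrow> nat \<Rightarrow> int poly poly" where
  "fac_quad r \<tau> j =
     (if \<tau> (Suc r, j) = \<tau> (r, j)
      then tvar ^ Suc (card (right r j) +
             card {i. 1 \<le> i \<and> i < j \<and> ht i = ht j \<and> \<tau> (Suc r, i) \<noteq> \<tau> (r, i)}) - qvar ^ (ht j - r)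
      else (tvar - 1) * qvar ^ ((ht j - r) * of_bool (\<tau> (r, j) < \<tau> (Suc r, j))) *
        tvar ^ card {k \<in> right r j. cyc (\<tau> (Suc r, j)) (\<tau> (r, j)) (\<tau> (r, k)) \<and>
                       \<not> (ht k = ht j \<and> \<tau> (Suc r, k) = \<tau> (r, k))})"

definition wt_quad :: "nat \<Rightarrow> (nat \<times> nat \<Rightarrow> nat) \<Rightarrow> int poly poly" where
  "wt_quad r \<tau> = (if lev_quad_na r \<tau> then (\<Prod>j\<in>cols r. fac_quad r \<tau> j) else 0)"

definition rowdist :: "(nat \<times> nat \<Rightarrow> nat) \<Rightarrow> bool" where
  "rowdist \<tau> \<longleftrightarrow> (\<forall>r j k. 1 \<le> r \<and> 1 \<le> j \<and> 1 \<le> k \<and> r \<le> ht j \<and> r \<le> ht k \<and> \<tau> (r, j) = \<tau> (r, k)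
     \<longrightarrow> j = k)"

definition sw :: "nat \<Rightarrow> nat \<Rightarrow> (nat \<times> nat \<Rightarrow> nat) \<Rightarrow> nat \<times> nat \<Rightarrow> nat" where
  "sw r i \<tau> = \<tau> \<circ> transpose (r, i) (r, Suc i)"

definition adm :: "nat \<Rightarrow> nat \<Rightarrow> bool" where
  "adm r i \<longleftrightarrow> 1 \<le> i \<and> ht i = ht (Suc i) \<and> r \<le> ht i"

definition hit :: "nat \<Rightarrow> (nat \<times> nat \<Rightarrow> nat) \<Rightarrow> nat \<Rightarrow> bool" where
  "hit r \<tau> k \<longleftrightarrow> (\<exists>j. 1 \<le> j \<and> ht j = ht k \<and> \<tau> (Suc r, k) = \<tau> (r, j))"

section \<open>Elementary facts on rows, columns and adjacent swaps\<close>

lemma rowdistD: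
  "\<lbrakk>rowdist \<tau>; \<tau> (r, j) = \<tau> (r, k); 1 \<le> r; 1 \<le> j; 1 \<le> k; r \<le> ht j; r \<le> ht k\<rbrakk> \<Longrightarrow> j = k"
  unfolding rowdist_def by blast

lemma lev_naD:
  "\<lbrakk>lev_quinv_na r \<tau>; 1 \<le> j; j < k; r < ht j; r \<le> ht k\<rbrakk> \<Longrightarrow> \<tau> (Suc r, j) \<noteq> \<tau> (r, k)"
  unfolding lev_quinv_na_def by blast

lemma lev_qnaD:
  "\<lbrakk>lev_quad_na r \<tau>; 1 \<le> j; 1 \<le> k; j \<noteq> k; r < ht j; r \<le> ht k; ht k \<le> ht j\<rbrakk>
    \<Longrightarrow> \<tau> (Suc r, j) \<noteq> \<tau> (r, k)"
  unfolding lev_quad_na_def by blast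

lemma sw_apply: "sw r i \<tau> (s, j) = (if s = r then \<tau> (r, transpose i (Suc i) j) else \<tau> (s, j))"
  by (auto simp: sw_def transpose_def)

lemma sw_sw: "sw r i (sw r i \<tau>) = \<tau>"
  by (simp add: sw_def o_assoc[symmetric])

lemma sw_commute: "r \<noteq> s \<Longrightarrow> sw r i (sw s k \<tau>) = sw s k (sw r i \<tau>)"
  by (rule ext) (auto simp: sw_def transpose_def)

lemma finite_right: "1 \<le> r \<Longrightarrow> finite (right r j)"
proof -
  assume "1 \<le> r"
  then have "right r j \<subseteq> snd ` dg lam"
    by (force simp: right_def dg_def image_iff intro!: exI[of _ r])
  then show ?thesis using finite_dg finite_surj by blast
qed

lemma finite_cols: "finite (cols r)"
proof -
  have "cols r \<subseteq> snd ` dg lam"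
    by (force simp: cols_def dg_def image_iff intro!: exI[of _ 1])
  then show ?thesis using finite_dg finite_surj by blast
qed

lemma right_ht: "k \<in> right r j \<Longrightarrow> ht k \<le> ht j"
  by (auto simp: right_def intro: colht_antimono)

lemma ht_transpose: "ht i = ht (Suc i) \<Longrightarrow> ht (transpose i (Suc i) j) = ht j"
  by (auto simp: transpose_def)

text \<open>Only \<open>j = i\<close> separates the columns \<open>i\<close> and
  \<open>Suc i\<close>; every other column has both or neither of them as candidates on its
  right.\<close>

lemma transpose_right:
  assumes "ht i = ht (Suc i)" "j \<noteq> i"
  shows "transpose i (Suc i) k \<in> right r j \<longleftrightarrow> k \<in> right r j"
  using assms by (auto simp: right_def transpose_def)

lemma transpose_image_right:
  assumes "ht i = ht (Suc i)" "j \<noteq> i"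
  shows "(\<lambda>k. f (transpose i (Suc i) k)) ` right r j = f ` right r j"
proof -
  have "transpose i (Suc i) ` right r j = right r j"
  proof safe
    fix k assume k: "k \<in> right r j"
    then show "transpose i (Suc i) k \<in> right r j" using transpose_right[OF assms] by blast
    then show "k \<in> transpose i (Suc i) ` right r j"
      by (intro image_eqI[of _ _ "transpose i (Suc i) k"]) simp_all
  qed
  then show ?thesis by (metis image_image)
qed

section \<open>The \<open>quinv\<close> weight under an adjacent swap\<close>

definition rest_quinv_na :: "nat \<Rightarrow> nat \<Rightarrow> (nat \<times> nat \<Rightarrow> nat) \<Rightarrow> bool" where
  "rest_quinv_na r i \<tau> \<longleftrightarrow> (\<forall>j k. 1 \<le> j \<and> j < k \<and> r < ht j \<and> r \<le> ht k \<and> (j, k) \<noteq> (i, Suc i)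
     \<longrightarrow> \<tau> (Suc r, j) \<noteq> \<tau> (r, k))"

definition rest_wt :: "nat \<Rightarrow> nat \<Rightarrow> (nat \<times> nat \<Rightarrow> nat) \<Rightarrow> int poly poly" where
  "rest_wt r i \<tau> = (if rest_quinv_na r i \<tau> then
     (\<Prod>j\<in>cols r - {i, Suc i}.
        colfac (ht j - r) ((\<lambda>k. \<tau> (r, k)) ` right r j) (\<tau> (Suc r, j)) (\<tau> (r, j))) else 0)"

text \<open>Transposing \<open>i\<close> and \<open>Suc i\<close> in one row preserves the order of
  every pair of columns \<open>j < k\<close> other than \<open>(i, Suc i)\<close>. That pair is left
  to \<open>colpair\<close>, which vanishes when it attacks.\<close>

lemma rest_quinv_na_sw:
  assumes "ht i = ht (Suc i)" "1 \<le> i" "s = r \<or> s = Suc r"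
  shows "rest_quinv_na r i (sw s i \<tau>) \<longleftrightarrow> rest_quinv_na r i \<tau>"
proof -
  let ?p = "transpose i (Suc i)"
  have imp: "rest_quinv_na r i (sw s i \<tau>)" if "rest_quinv_na r i \<tau>" for \<tau>
  proof -
    have "sw s i \<tau> (Suc r, j) \<noteq> sw s i \<tau> (r, k)"
      if a: "1 \<le> j" "j < k" "r < ht j" "r \<le> ht k" "(j, k) \<noteq> (i, Suc i)" for j k
    proof (cases "s = r")
      case True
      have "j < ?p k" "(j, ?p k) \<noteq> (i, Suc i)"
        using a by (auto simp: transpose_def)
      with \<open>rest_quinv_na r i \<tau>\<close> a True show ?thesis
        by (auto simp: rest_quinv_na_def sw_apply ht_transpose[OF assms(1)])
    next
      case False
      have "?p j < k" "(?p j, k) \<noteq> (i, Suc i)" "1 \<le> ?p j"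
        using a assms(2) by (auto simp: transpose_def)
      with \<open>rest_quinv_na r i \<tau>\<close> a False assms(3) show ?thesis
        by (auto simp: rest_quinv_na_def sw_apply ht_transpose[OF assms(1)])
    qed
    then show ?thesis by (auto simp: rest_quinv_na_def)
  qed
  show ?thesis using imp[of \<tau>] imp[of "sw s i \<tau>"] by (auto simp: sw_sw)
qed

text \<open>The other columns see the entries to their right only as a set, and the swap does not
  change that set.\<close>

lemma rest_wt_sw:
  assumes "ht i = ht (Suc i)" "1 \<le> i" "s = r \<or> s = Suc r"
  shows "rest_wt r i (sw s i \<tau>) = rest_wt r i \<tau>"
proof -
  have "colfac (ht j - r) ((\<lambda>k. sw s i \<tau> (r, k)) ` right r j) (sw s i \<tau> (Suc r, j)) (sw s i \<tau> (r, j))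
      = colfac (ht j - r) ((\<lambda>k. \<tau> (r, k)) ` right r j) (\<tau> (Suc r, j)) (\<tau> (r, j))"
    if "j \<in> cols r - {i, Suc i}" for j
    using that assms transpose_image_right[of i j "\<lambda>k. \<tau> (r, k)" r] by (auto simp: sw_apply)
  then show ?thesis using rest_quinv_na_sw[OF assms] by (simp add: rest_wt_def)
qed

lemma wt_quinv_split:
  assumes "adm (Suc r) i" "1 \<le> r"
  shows "wt_quinv r \<tau> = rest_wt r i \<tau> * colpair (ht i - r) ((\<lambda>k. \<tau> (r, k)) ` right r (Suc i))
     (\<tau> (Suc r, i)) (\<tau> (Suc r, Suc i)) (\<tau> (r, i)) (\<tau> (r, Suc i))"
proof -
  have h: "1 \<le> i" "ht (Suc i) = ht i" "r < ht i" using assms by (auto simp: adm_def)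
  have na: "lev_quinv_na r \<tau> \<longleftrightarrow> rest_quinv_na r i \<tau> \<and> \<tau> (Suc r, i) \<noteq> \<tau> (r, Suc i)"
    unfolding lev_quinv_na_def rest_quinv_na_def using h by auto
  have ri: "right r i = insert (Suc i) (right r (Suc i))"
    using h by (auto simp: right_def)
  have "prod f (cols r) = f i * f (Suc i) * prod f (cols r - {i, Suc i})"
    for f :: "nat \<Rightarrow> int poly poly"
  proof -
    have "i \<in> cols r" "Suc i \<in> cols r - {i}" using h by (auto simp: cols_def)
    moreover have "cols r - {i} - {Suc i} = cols r - {i, Suc i}" by blast
    ultimately show ?thesis
      using finite_cols[of r] by (simp add: prod.remove[of _ i] prod.remove[of _ "Suc i"] mult.assoc)
  qed
  then show ?thesis
    by (simp add: wt_quinv_def rest_wt_def colpair_def na ri h ac_simps)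
qed

text \<open>The common factor \<open>rest_wt\<close> splits off from all four terms; what remains is
  \<open>colpair_exchange\<close>, with \<open>C\<close> the lower entries to the right of both
  columns.\<close>

lemma wt_quinv_exchange:
  assumes "adm (Suc r) i" "1 \<le> r" "rowdist \<tau>"
  shows "wt_quinv r \<tau> + wt_quinv r (sw r i \<tau>) = wt_quinv r (sw (Suc r) i \<tau>) + wt_quinv r (sw r i (sw (Suc r) i \<tau>))"
proof (cases "rest_quinv_na r i \<tau>")
  case True
  have h: "1 \<le> i" "ht i = ht (Suc i)" "r < ht i" using assms by (auto simp: adm_def)
  let ?z = "\<tau> (Suc r, i)" and ?w = "\<tau> (Suc r, Suc i)" and ?u = "\<tau> (r, i)" and ?v = "\<tau> (r, Suc i)"
  let ?C = "(\<lambda>k. \<tau> (r, k)) ` right r (Suc i)"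
  have C: "(\<lambda>k. \<tau> (r, transpose i (Suc i) k)) ` right r (Suc i) = ?C"
    using transpose_image_right[of i "Suc i" "\<lambda>k. \<tau> (r, k)" r] h by simp
  have ne: "?z \<noteq> ?w" "?u \<noteq> ?v"
    using rowdistD[OF assms(3), of r i "Suc i"] rowdistD[OF assms(3), of "Suc r" i "Suc i"] assms(2) h
    by auto
  \<comment> \<open>The upper entries avoid \<open>C\<close> by the non-attacking condition, the
    lower ones because their row has distinct entries.\<close>
  have "?z \<notin> ?C" "?w \<notin> ?C"
    using True h by (auto simp: rest_quinv_na_def right_def)
  moreover have "?u \<notin> ?C" "?v \<notin> ?C"
  proof -
    have "j = k" if "\<tau> (r, j) = \<tau> (r, k)" "j \<in> {i, Suc i}" "k \<in> right r (Suc i)" for j k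
      using rowdistD[OF assms(3) that(1) assms(2)] that(2,3) h by (auto simp: right_def)
    then show "?u \<notin> ?C" "?v \<notin> ?C" by (fastforce simp: right_def)+
  qed
  ultimately have dis: "{?z, ?w, ?u, ?v} \<inter> ?C = {}" by auto
  have "finite ?C" using finite_right assms(2) by blast
  from colpair_exchange[OF this dis ne, of "ht i - r"] show ?thesis
    unfolding wt_quinv_split[OF assms(1,2)]
    using h by (simp add: rest_wt_sw sw_apply C distrib_left[symmetric])
next
  case False
  with assms show ?thesis
    unfolding wt_quinv_split[OF assms(1,2)] by (simp add: rest_wt_sw adm_def) (simp add: rest_wt_def)
qed

section \<open>The \<open>quadcoinv\<close> weight under a simultaneous swap in both rows\<close>

lemma lev_quad_na_sw_sw:
  assumes "adm (Suc r) i"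
  shows "lev_quad_na r (sw r i (sw (Suc r) i \<tau>)) \<longleftrightarrow> lev_quad_na r \<tau>"
proof -
  let ?p = "transpose i (Suc i)"
  have h: "1 \<le> i" "ht i = ht (Suc i)" using assms by (auto simp: adm_def)
  have imp: "lev_quad_na r (sw r i (sw (Suc r) i \<tau>))" if "lev_quad_na r \<tau>" for \<tau>
    unfolding lev_quad_na_def
  proof (intro allI impI)
    fix j k
    assume a: "1 \<le> j \<and> 1 \<le> k \<and> j \<noteq> k \<and> r < ht j \<and> r \<le> ht k \<and> ht k \<le> ht j"
    then have "1 \<le> ?p j \<and> 1 \<le> ?p k \<and> ?p j \<noteq> ?p k" using h by (auto simp: transpose_def)
    with a have "\<tau> (Suc r, ?p j) \<noteq> \<tau> (r, ?p k)"
      using that ht_transpose[OF h(2)] unfolding lev_quad_na_def by metis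
    then show "sw r i (sw (Suc r) i \<tau>) (Suc r, j) \<noteq> sw r i (sw (Suc r) i \<tau>) (r, k)"
      by (simp add: sw_apply)
  qed
  have "sw r i (sw (Suc r) i (sw r i (sw (Suc r) i \<tau>))) = \<tau>"
    by (simp add: sw_commute[of r "Suc r"] sw_sw)
  then show ?thesis using imp[of \<tau>] imp[of "sw r i (sw (Suc r) i \<tau>)"] by auto
qed

text \<open>Call a column diagonal if its two entries agree. The swap moves a diagonal column to the
  left past a non-diagonal one. The exponent of a diagonal column counts all columns on its right
  and the non-diagonal ones of its height on its left, so the passed column is counted before and
  after; a non-diagonal column ignores diagonal ones of its height.\<close>

lemma wt_quad_sw_sw:
  assumes adm: "adm (Suc r) i" and r: "1 \<le> r"
    and hit: "\<not> hit r \<tau> i" "hit r \<tau> (Suc i)"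
  shows "wt_quad r (sw r i (sw (Suc r) i \<tau>)) = wt_quad r \<tau>"
proof (cases "lev_quad_na r \<tau>")
  case True
  let ?p = "transpose i (Suc i)"
  define \<tau>' where "\<tau>' = sw r i (sw (Suc r) i \<tau>)"
  have h: "1 \<le> i" "ht i = ht (Suc i)" "r < ht i" using adm by (auto simp: adm_def)
  have t': "\<tau>' (Suc r, j) = \<tau> (Suc r, ?p j)" "\<tau>' (r, j) = \<tau> (r, ?p j)" for j
    by (simp_all add: \<tau>'_def sw_apply)
  \<comment> \<open>By \<open>lev_quad_na\<close> a hit can only be the entry directly
    below.\<close>
  have eq: "\<tau> (Suc r, Suc i) = \<tau> (r, Suc i)"
  proof -
    from hit(2) obtain j where j: "1 \<le> j" "ht j = ht (Suc i)" "\<tau> (Suc r, Suc i) = \<tau> (r, j)"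
      by (auto simp: hit_def)
    then show ?thesis using lev_qnaD[OF True, of "Suc i" j] h by (cases "j = Suc i") auto
  qed
  have neq: "\<tau> (Suc r, i) \<noteq> \<tau> (r, i)"
    using hit(1) h unfolding hit_def by blast
  have ri: "right r i = insert (Suc i) (right r (Suc i))"
    using h by (auto simp: right_def)
  have notin: "Suc i \<notin> right r (Suc i)" by (simp add: right_def)
  have pj: "?p j = j" if "j \<noteq> i" "j \<noteq> Suc i" for j using that by (simp add: transpose_def)
  have fac: "fac_quad r \<tau>' j = fac_quad r \<tau> (?p j)" if "j \<in> cols r" for j
  proof -
    consider "j = i" | "j = Suc i" | "j \<noteq> i" "j \<noteq> Suc i" by blast
    then show ?thesis
    proof cases
      \<comment> \<open>The diagonal column is now at \<open>i\<close>. Its right set has gained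
        \<open>Suc i\<close>, while its left count has lost the non-diagonal column formerly at
        \<open>i\<close>.\<close>
      case 1
      have "{k. 1 \<le> k \<and> k < Suc i \<and> ht k = ht (Suc i) \<and> \<tau> (Suc r, k) \<noteq> \<tau> (r, k)} =
        insert i {k. 1 \<le> k \<and> k < i \<and> ht k = ht i \<and> \<tau> (Suc r, k) \<noteq> \<tau> (r, k)}"
        using h neq by auto
      moreover have "{k. 1 \<le> k \<and> k < i \<and> ht k = ht i \<and> \<tau> (Suc r, ?p k) \<noteq> \<tau> (r, ?p k)} =
        {k. 1 \<le> k \<and> k < i \<and> ht k = ht i \<and> \<tau> (Suc r, k) \<noteq> \<tau> (r, k)}"
        by (auto simp: transpose_def)
      ultimately show ?thesis
        using 1 h eq finite_right[OF r] notin by (simp add: fac_quad_def t' ri)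
    next
      \<comment> \<open>The non-diagonal column has lost the diagonal one from its right set, but
        that one was excluded from its count.\<close>
      case 2
      have "{k \<in> right r (Suc i). cyc (\<tau> (Suc r, i)) (\<tau> (r, i)) (\<tau> (r, ?p k)) \<and>
               \<not> (ht k = ht (Suc i) \<and> \<tau> (Suc r, ?p k) = \<tau> (r, ?p k))} =
        {k \<in> right r i. cyc (\<tau> (Suc r, i)) (\<tau> (r, i)) (\<tau> (r, k)) \<and>
               \<not> (ht k = ht i \<and> \<tau> (Suc r, k) = \<tau> (r, k))}"
        using h eq by (auto simp: right_def transpose_def split: if_splits)
      then show ?thesis
        using 2 h neq by (simp add: fac_quad_def t')
    next
      \<comment> \<open>Both swapped columns lie on the same side of \<open>j\<close>, so the sets
        counted at \<open>j\<close> are carried to each other by the transposition.\<close>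
      case 3
      have inj: "inj_on ?p A" for A by (rule inj_on_subset[OF inj_transpose]) simp
      have im: "{k. P (?p k)} = ?p ` {k. P k}" for P
      proof safe
        fix k assume "P (?p k)"
        then show "k \<in> ?p ` {k. P k}" by (intro image_eqI[of _ _ "?p k"]) simp_all
      qed simp
      have "{k. 1 \<le> k \<and> k < j \<and> ht k = ht j \<and> \<tau>' (Suc r, k) \<noteq> \<tau>' (r, k)} =
        {k. 1 \<le> ?p k \<and> ?p k < j \<and> ht (?p k) = ht j \<and> \<tau> (Suc r, ?p k) \<noteq> \<tau> (r, ?p k)}"
        using 3 h by (auto simp: t' transpose_def split: if_splits)
      then have 1: "card {k. 1 \<le> k \<and> k < j \<and> ht k = ht j \<and> \<tau>' (Suc r, k) \<noteq> \<tau>' (r, k)} =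
        card {k. 1 \<le> k \<and> k < j \<and> ht k = ht j \<and> \<tau> (Suc r, k) \<noteq> \<tau> (r, k)}"
        using im[of "\<lambda>k. 1 \<le> k \<and> k < j \<and> ht k = ht j \<and> \<tau> (Suc r, k) \<noteq> \<tau> (r, k)"]
        by (simp add: card_image[OF inj])
      have "{k \<in> right r j. cyc (\<tau>' (Suc r, j)) (\<tau>' (r, j)) (\<tau>' (r, k)) \<and>
                       \<not> (ht k = ht j \<and> \<tau>' (Suc r, k) = \<tau>' (r, k))} =
         {k. ?p k \<in> right r j \<and> cyc (\<tau> (Suc r, j)) (\<tau> (r, j)) (\<tau> (r, ?p k)) \<and>
                       \<not> (ht (?p k) = ht j \<and> \<tau> (Suc r, ?p k) = \<tau> (r, ?p k))}"
        using 3 h by (simp add: t' ht_transpose transpose_right pj)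
      then have 2: "card {k \<in> right r j. cyc (\<tau>' (Suc r, j)) (\<tau>' (r, j)) (\<tau>' (r, k)) \<and>
                       \<not> (ht k = ht j \<and> \<tau>' (Suc r, k) = \<tau>' (r, k))} =
          card {k \<in> right r j. cyc (\<tau> (Suc r, j)) (\<tau> (r, j)) (\<tau> (r, k)) \<and>
                       \<not> (ht k = ht j \<and> \<tau> (Suc r, k) = \<tau> (r, k))}"
        using im[of "\<lambda>k. k \<in> right r j \<and> cyc (\<tau> (Suc r, j)) (\<tau> (r, j)) (\<tau> (r, k)) \<and>
                       \<not> (ht k = ht j \<and> \<tau> (Suc r, k) = \<tau> (r, k))"]
        by (simp add: card_image[OF inj])
      show ?thesis unfolding fac_quad_def 1 2 using 3 by (simp add: t' pj)
    qed
  qed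
  have "(\<Prod>j\<in>cols r. fac_quad r \<tau>' j) = (\<Prod>j\<in>cols r. fac_quad r \<tau> (?p j))"
    using fac by simp
  also have "\<dots> = (\<Prod>j\<in>cols r. fac_quad r \<tau> j)"
    by (rule prod.reindex_bij_witness[of _ ?p ?p])
      (use h in \<open>auto simp: cols_def ht_transpose transpose_def\<close>)
  finally show ?thesis
    using True lev_quad_na_sw_sw[OF adm, of \<tau>] by (simp add: wt_quad_def \<tau>'_def)
next
  case False
  then show ?thesis using lev_quad_na_sw_sw[OF adm, of \<tau>] by (simp add: wt_quad_def)
qed

text \<open>Swapping the upper entries at a bad position moves a hit to the left.\<close>

definition bad :: "nat \<Rightarrow> (nat \<times> nat \<Rightarrow> nat) \<Rightarrow> nat \<Rightarrow> bool" where
  "bad r \<tau> i \<longleftrightarrow> adm (Suc r) i \<and> \<not> hit r \<tau> i \<and> hit r \<tau> (Suc i)"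

text \<open>When the hits come first in each block of equal heights, they are diagonal as soon as
  the rows do not attack. Diagonal columns then precede the non-diagonal ones of their height, so
  the corrections in \<open>fac_quad\<close> are empty and it reduces to
  \<open>colfac\<close>.\<close>

lemma wt_quinv_eq_wt_quad_if_sorted:
  assumes sorted: "\<And>i. \<not> bad r \<tau> i" and r: "1 \<le> r" and dist: "rowdist \<tau>"
  shows "wt_quinv r \<tau> = wt_quad r \<tau>"
proof -
  \<comment> \<open>Absence of bad positions lets hits propagate to the left inside a block of equal
    heights.\<close>
  have initial: "hit r \<tau> j" if "hit r \<tau> k" "j \<le> k" "1 \<le> j" "ht j = ht k" "r < ht k" for j k
    using that(2,1,3-)
  proof (induction k rule: dec_induct)
    case (step n)
    have "ht j = ht n"
      using step.prems step.hyps by (metis colht_antimono le_antisym lessI less_imp_le less_or_eq_imp_le)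
    then have "adm (Suc r) n" using step by (auto simp: adm_def)
    then have "hit r \<tau> n" using sorted[of n] step.prems by (auto simp: bad_def)
    then show ?case using step \<open>ht j = ht n\<close> by simp
  qed
  \<comment> \<open>A column \<open>j\<close> holding the entry below cannot be to the right of
    \<open>k\<close>, as this attacks. If it were to the left, it would be a hit as well, hence
    diagonal by induction, and the upper row would repeat an entry.\<close>
  have col: "\<tau> (Suc r, k) = \<tau> (r, k)"
    if "lev_quinv_na r \<tau>" "hit r \<tau> k" "1 \<le> k" "r < ht k" for k
    using that(2-)
  proof (induction k rule: less_induct)
    case (less k)
    then obtain j where j: "1 \<le> j" "ht j = ht k" "\<tau> (Suc r, k) = \<tau> (r, j)"
      by (auto simp: hit_def)
    consider "j = k" | "k < j" | "j < k" by linarith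
    then show ?case
    proof cases
      case 2
      then show ?thesis using lev_naD[OF that(1), of k j] j less.prems by simp
    next
      case 3
      then have "hit r \<tau> j" using initial[of k j] j less.prems by simp
      then have "\<tau> (Suc r, j) = \<tau> (r, j)" using less.IH[OF 3] j less.prems by simp
      then have "\<tau> (Suc r, j) = \<tau> (Suc r, k)" using j by simp
      then have "j = k" using rowdistD[OF dist, of "Suc r" j k] j less.prems by simp
      then show ?thesis using j by simp
    qed (use j in simp)
  qed
  have hitI: "hit r \<tau> k" if "\<tau> (Suc r, k) = \<tau> (r, j)" "1 \<le> j" "ht j = ht k" for j k
    using that by (auto simp: hit_def)
  \<comment> \<open>Only a type III attack could separate the two conditions; by \<open>col\<close>
    it would repeat an entry in the lower row.\<close>
  have na: "lev_quinv_na r \<tau> \<longleftrightarrow> lev_quad_na r \<tau>"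
  proof
    assume A: "lev_quinv_na r \<tau>"
    show "lev_quad_na r \<tau>" unfolding lev_quad_na_def
    proof (intro allI impI notI)
      fix j k
      assume a: "1 \<le> j \<and> 1 \<le> k \<and> j \<noteq> k \<and> r < ht j \<and> r \<le> ht k \<and> ht k \<le> ht j"
        and e: "\<tau> (Suc r, j) = \<tau> (r, k)"
      show False
      proof (cases "j < k")
        case True
        then show False using A a e unfolding lev_quinv_na_def by blast
      next
        case False
        then have "ht j = ht k" using a colht_antimono[of k j lam] by simp
        then have "\<tau> (r, j) = \<tau> (r, k)" using col[OF A hitI, of j k] a e by simp
        then show False using rowdistD[OF dist, of r j k] a r by simp
      qed
    qed
  next
    assume B: "lev_quad_na r \<tau>"
    show "lev_quinv_na r \<tau>" unfolding lev_quinv_na_def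
    proof (intro allI impI)
      fix j k assume "1 \<le> j \<and> j < k \<and> r < ht j \<and> r \<le> ht k"
      then show "\<tau> (Suc r, j) \<noteq> \<tau> (r, k)"
        using lev_qnaD[OF B, of j k] colht_antimono[of j k lam] by simp
    qed
  qed
  show ?thesis
  proof (cases "lev_quinv_na r \<tau>")
    case True
    have "colfac (ht j - r) ((\<lambda>k. \<tau> (r, k)) ` right r j) (\<tau> (Suc r, j)) (\<tau> (r, j)) = fac_quad r \<tau> j"
      if "j \<in> cols r" for j
    proof -
      have j: "1 \<le> j" "r < ht j" using that by (auto simp: cols_def)
      have inj: "inj_on (\<lambda>k. \<tau> (r, k)) (right r j)"
        using rowdistD[OF dist, of r] r j by (auto simp: inj_on_def right_def)
      have card: "card ((\<lambda>k. \<tau> (r, k)) ` right r j) = card (right r j)"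
        using inj by (rule card_image)
      show ?thesis
      proof (cases "\<tau> (Suc r, j) = \<tau> (r, j)")
        case eq: True
        \<comment> \<open>Columns of the same height to the left of a diagonal one are hits, hence
          diagonal.\<close>
        have "{i. 1 \<le> i \<and> i < j \<and> ht i = ht j \<and> \<tau> (Suc r, i) \<noteq> \<tau> (r, i)} = {}"
        proof safe
          fix i assume i: "1 \<le> i" "i < j" "ht i = ht j" "\<tau> (Suc r, i) \<noteq> \<tau> (r, i)"
          have "hit r \<tau> i" using initial[of j i] hitI[OF eq] i j by simp
          then show "i \<in> {}" using col[OF True] i j by simp
        qed
        then show ?thesis using eq by (simp only: fac_quad_def colfac_def card if_True card.empty add_0_right simp_thms)
      next
        case neq: False
        \<comment> \<open>A diagonal column of the same height on the right would make
          \<open>j\<close> diagonal too.\<close>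
        have "\<not> (ht k = ht j \<and> \<tau> (Suc r, k) = \<tau> (r, k))" if "k \<in> right r j" for k
        proof
          assume k: "ht k = ht j \<and> \<tau> (Suc r, k) = \<tau> (r, k)"
          then have "hit r \<tau> k" using that j hitI[of k k] by (auto simp: right_def)
          then have "hit r \<tau> j" using initial[of k j] that j k by (auto simp: right_def)
          then show False using col[OF True] j neq by simp
        qed
        then have "{k \<in> right r j. cyc (\<tau> (Suc r, j)) (\<tau> (r, j)) (\<tau> (r, k)) \<and>
                       \<not> (ht k = ht j \<and> \<tau> (Suc r, k) = \<tau> (r, k))} =
          {k \<in> right r j. cyc (\<tau> (Suc r, j)) (\<tau> (r, j)) (\<tau> (r, k))}" by blast
        then show ?thesis using neq unfolding fac_quad_def by (simp add: colfac_def ncyc_image[OF inj])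
      qed
    qed
    then show ?thesis using True na by (simp add: wt_quinv_def wt_quad_def)
  next
    case False
    then show ?thesis using na by (simp add: wt_quinv_def wt_quad_def)
  qed
qed


section \<open>Termination of the sorting, and locality of the weights\<close>

definition hitpos :: "nat \<Rightarrow> (nat \<times> nat \<Rightarrow> nat) \<Rightarrow> nat" where
  "hitpos r \<tau> = (\<Sum>k\<in>{k \<in> cols r. hit r \<tau> k}. k)"

text \<open>A swap in row \<open>r\<close> moves lower entries only within a block of equal heights,
  and \<open>hit\<close> asks only in which block an entry occurs.\<close>

lemma hit_sw_low:
  assumes "adm s i" "s \<le> r"
  shows "hit r (sw s i \<tau>) k \<longleftrightarrow> hit r \<tau> k"
proof -
  have h: "1 \<le> i" "ht i = ht (Suc i)" using assms by (auto simp: adm_def)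
  have "1 \<le> transpose i (Suc i) j \<longleftrightarrow> 1 \<le> j" for j using h by (auto simp: transpose_def)
  then have ex: "(\<exists>j. 1 \<le> j \<and> ht j = x \<and> c = \<tau> (r, transpose i (Suc i) j)) \<longleftrightarrow>
      (\<exists>j. 1 \<le> j \<and> ht j = x \<and> c = \<tau> (r, j))" for x c
    by (metis ht_transpose[OF h(2)] transpose_involutory)
  show ?thesis using ex assms(2) by (cases "s = r") (simp_all add: hit_def sw_apply)
qed

lemma hit_sw_high:
  assumes "ht i = ht (Suc i)"
  shows "hit r (sw (Suc r) i \<tau>) k \<longleftrightarrow> hit r \<tau> (transpose i (Suc i) k)"
  by (simp add: hit_def sw_apply ht_transpose[OF assms])

text \<open>The swap replaces \<open>Suc i\<close> by \<open>i\<close> in the set of hit columns;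
  this decrease is what ends the sorting.\<close>

lemma hitpos_sw:
  assumes "bad r \<tau> i"
  shows "hitpos r (sw (Suc r) i \<tau>) < hitpos r \<tau>"
proof -
  have h: "1 \<le> i" "ht i = ht (Suc i)" "r < ht i" "\<not> hit r \<tau> i" "hit r \<tau> (Suc i)"
    using assms by (auto simp: bad_def adm_def)
  define H where "H = {k \<in> cols r. hit r \<tau> k} - {Suc i}"
  have H: "finite H" "i \<notin> H" "Suc i \<notin> H" using h finite_cols by (auto simp: H_def)
  have "{k \<in> cols r. hit r \<tau> k} = insert (Suc i) H"
    using h by (auto simp: H_def cols_def)
  moreover have "{k \<in> cols r. hit r (sw (Suc r) i \<tau>) k} = insert i H"
    using h by (auto simp: H_def cols_def hit_sw_high transpose_def split: if_splits)
  ultimately show ?thesis using H by (simp add: hitpos_def)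
qed

lemma wt_quinv_cong:
  assumes "\<And>j. \<tau> (r, j) = \<tau>' (r, j)" "\<And>j. \<tau> (Suc r, j) = \<tau>' (Suc r, j)"
  shows "wt_quinv r \<tau> = wt_quinv r \<tau>'"
  by (simp only: wt_quinv_def lev_quinv_na_def assms)

lemma wt_quad_cong:
  assumes "\<And>j. \<tau> (r, j) = \<tau>' (r, j)" "\<And>j. \<tau> (Suc r, j) = \<tau>' (Suc r, j)"
  shows "wt_quad r \<tau> = wt_quad r \<tau>'"
  by (simp only: wt_quad_def lev_quad_na_def fac_quad_def assms)

lemma wt_quinv_sw_far: "s \<noteq> r \<Longrightarrow> s \<noteq> Suc r \<Longrightarrow> wt_quinv r (sw s i \<tau>) = wt_quinv r \<tau>"
  by (rule wt_quinv_cong) (auto simp: sw_apply)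

lemma wt_quad_sw_far: "s \<noteq> r \<Longrightarrow> s \<noteq> Suc r \<Longrightarrow> wt_quad r (sw s i \<tau>) = wt_quad r \<tau>"
  by (rule wt_quad_cong) (auto simp: sw_apply)

section \<open>Weighted sums over a set of fillings closed under swaps\<close>

context
  fixes F :: "(nat \<times> nat \<Rightarrow> nat) set"
begin

text \<open>Only columns that continue above row \<open>r\<close> are swapped in it. Swaps of top
  boxes are left out because they would change the inversions among the tops of columns.\<close>

definition symbelow :: "nat \<Rightarrow> ((nat \<times> nat \<Rightarrow> nat) \<Rightarrow> int poly poly) \<Rightarrow> bool" where
  "symbelow m G \<longleftrightarrow> (\<forall>r i \<tau>. 1 \<le> r \<and> r < m \<and> adm (Suc r) i \<and> \<tau> \<in> F \<longrightarrow> G (sw r i \<tau>) = G \<tau>)"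

text \<open>\<open>G\<close> is a test function for everything from row \<open>m\<close> upwards; in
  the inductions, weights pass from the product into \<open>G\<close>.\<close>

definition sum_quinv :: "nat \<Rightarrow> ((nat \<times> nat \<Rightarrow> nat) \<Rightarrow> int poly poly) \<Rightarrow> int poly poly" where
  "sum_quinv m G = (\<Sum>\<tau>\<in>F. (\<Prod>r = 1..<m. wt_quinv r \<tau>) * G \<tau>)"

definition sum_quad :: "nat \<Rightarrow> ((nat \<times> nat \<Rightarrow> nat) \<Rightarrow> int poly poly) \<Rightarrow> int poly poly" where
  "sum_quad m G = (\<Sum>\<tau>\<in>F. (\<Prod>r = 1..<m. wt_quad r \<tau>) * G \<tau>)"

context
  assumes finF: "finite F"
    and swF: "\<And>r i \<tau>. 1 \<le> r \<Longrightarrow> adm r i \<Longrightarrow> \<tau> \<in> F \<Longrightarrow> sw r i \<tau> \<in> F"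
    and distF: "\<And>\<tau>. \<tau> \<in> F \<Longrightarrow> rowdist \<tau>"
begin

lemma adm_Suc: "adm (Suc r) i \<Longrightarrow> adm r i"
  by (simp add: adm_def)

lemma symbelowD:
  "\<lbrakk>symbelow m G; 1 \<le> r; r < m; adm (Suc r) i; \<tau> \<in> F\<rbrakk> \<Longrightarrow> G (sw r i \<tau>) = G \<tau>"
  by (simp add: symbelow_def)

lemma symbelow_mono: "symbelow m G \<Longrightarrow> m' \<le> m \<Longrightarrow> symbelow m' G"
  by (auto simp: symbelow_def)

lemma symbelow_mult: "symbelow m G \<Longrightarrow> symbelow m H \<Longrightarrow> symbelow m (\<lambda>\<tau>. G \<tau> * H \<tau>)"
  by (auto simp: symbelow_def)

lemma symbelow_wt_quinv: "symbelow m (wt_quinv m)"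
  by (auto simp: symbelow_def wt_quinv_sw_far)

lemma symbelow_wt_quad: "symbelow m (wt_quad m)"
  by (auto simp: symbelow_def wt_quad_sw_far)

lemma symbelow_sw:
  assumes "symbelow m G" "m \<le> s" "1 \<le> s" "adm s k"
  shows "symbelow m (\<lambda>\<tau>. G (sw s k \<tau>))"
  unfolding symbelow_def
proof (intro allI impI)
  fix r i \<tau> assume a: "1 \<le> r \<and> r < m \<and> adm (Suc r) i \<and> \<tau> \<in> F"
  then have "G (sw s k (sw r i \<tau>)) = G (sw r i (sw s k \<tau>))"
    using assms(2) by (simp add: sw_commute)
  also have "\<dots> = G (sw s k \<tau>)"
    using symbelowD[OF assms(1)] a swF assms by simp
  finally show "G (sw s k (sw r i \<tau>)) = G (sw s k \<tau>)" .
qed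

lemma sum_quinv_cong: "(\<And>\<tau>. \<tau> \<in> F \<Longrightarrow> G \<tau> = H \<tau>) \<Longrightarrow> sum_quinv m G = sum_quinv m H"
  by (simp add: sum_quinv_def)

lemma sum_quinv_add: "sum_quinv m (\<lambda>\<tau>. G \<tau> + H \<tau>) = sum_quinv m G + sum_quinv m H"
  by (simp add: sum_quinv_def distrib_left sum.distrib)

lemma sum_quinv_sum: "sum_quinv m (\<lambda>\<tau>. \<Sum>i\<in>I. G i \<tau>) = (\<Sum>i\<in>I. sum_quinv m (G i))"
  unfolding sum_quinv_def sum_distrib_left by (rule sum.swap)

lemma sum_quinv_Suc: "1 \<le> m \<Longrightarrow> sum_quinv (Suc m) G = sum_quinv m (\<lambda>\<tau>. wt_quinv m \<tau> * G \<tau>)"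
  by (simp add: sum_quinv_def mult.assoc)

lemma sum_quinv_reindex:
  assumes "m < s" "adm s i"
  shows "sum_quinv m (\<lambda>\<tau>. G (sw s i \<tau>)) = sum_quinv m G"
proof -
  have "(\<Prod>r = 1..<m. wt_quinv r (sw s i \<tau>)) = (\<Prod>r = 1..<m. wt_quinv r \<tau>)" for \<tau>
    using assms by (intro prod.cong refl wt_quinv_sw_far) auto
  then show ?thesis
    unfolding sum_quinv_def
    by (intro sum.reindex_bij_witness[of _ "sw s i" "sw s i"]) (use swF assms in \<open>auto simp: sw_sw\<close>)
qed

text \<open>Symmetry in the entries of row \<open>m\<close>, by induction on rows. By the induction
  hypothesis the weight of the next pair of rows may be averaged over a swap in its lower row, and
  \<open>wt_quinv_exchange\<close> makes the average symmetric in its upper row. In row 1 there are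
  no weights and reindexing suffices.\<close>

lemma sum_quinv_sw:
  assumes "1 \<le> m" "adm m i" "symbelow m G"
  shows "sum_quinv m (\<lambda>\<tau>. G (sw m i \<tau>)) = sum_quinv m G"
  using assms
proof (induction m arbitrary: G rule: dec_induct)
  case base
  show ?case unfolding sum_quinv_def
    by (intro sum.reindex_bij_witness[of _ "sw 1 i" "sw 1 i"]) (use swF base in \<open>auto simp: sw_sw\<close>)
next
  case (step m)
  let ?s = "sw m i" and ?s' = "sw (Suc m) i"
  have m: "1 \<le> m" "adm m i" using step by (auto intro: adm_Suc)
  \<comment> \<open>Doubling replaces averaging, which would need division by 2. \<open>H\<close> is
    not affected by the swap in row \<open>m\<close>, since it is symmetric in all rows below
    \<open>Suc m\<close>.\<close>
  have double: "sum_quinv (Suc m) H + sum_quinv (Suc m) H = sum_quinv m (\<lambda>\<tau>. (wt_quinv m \<tau> + wt_quinv m (?s \<tau>)) * H \<tau>)"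
    if H: "symbelow (Suc m) H" for H
  proof -
    have "symbelow m (\<lambda>\<tau>. wt_quinv m \<tau> * H \<tau>)"
      by (intro symbelow_mult symbelow_wt_quinv symbelow_mono[OF H]) simp
    from step.IH[OF m(2) this] have "sum_quinv (Suc m) H = sum_quinv m (\<lambda>\<tau>. wt_quinv m (?s \<tau>) * H (?s \<tau>))"
      using m by (simp add: sum_quinv_Suc)
    also have "\<dots> = sum_quinv m (\<lambda>\<tau>. wt_quinv m (?s \<tau>) * H \<tau>)"
      using symbelowD[OF H m(1)] step.prems(1) by (intro sum_quinv_cong) simp
    finally show ?thesis using m by (simp add: sum_quinv_Suc sum_quinv_add distrib_right)
  qed
  have "sum_quinv (Suc m) (\<lambda>\<tau>. G (?s' \<tau>)) + sum_quinv (Suc m) (\<lambda>\<tau>. G (?s' \<tau>)) =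
      sum_quinv m (\<lambda>\<tau>. (wt_quinv m \<tau> + wt_quinv m (?s \<tau>)) * G (?s' \<tau>))"
    by (rule double, rule symbelow_sw) (use step.prems in auto)
  also have "\<dots> = sum_quinv m (\<lambda>\<tau>. (wt_quinv m (?s' \<tau>) + wt_quinv m (?s (?s' \<tau>))) * G \<tau>)"
    using sum_quinv_reindex[of m "Suc m" i "\<lambda>\<tau>. (wt_quinv m (?s' \<tau>) + wt_quinv m (?s (?s' \<tau>))) * G \<tau>"]
      step.prems(1) by (simp add: sw_sw)
  also have "\<dots> = sum_quinv m (\<lambda>\<tau>. (wt_quinv m \<tau> + wt_quinv m (?s \<tau>)) * G \<tau>)"
    using wt_quinv_exchange[OF step.prems(1) m(1) distF] by (intro sum_quinv_cong) simp
  also have "\<dots> = sum_quinv (Suc m) G + sum_quinv (Suc m) G"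
    using double[OF step.prems(2)] by simp
  \<comment> \<open>The coefficient ring has characteristic 0 and no zero divisors, so the factor 2
    cancels.\<close>
  finally have "2 * sum_quinv (Suc m) (\<lambda>\<tau>. G (?s' \<tau>)) = 2 * sum_quinv (Suc m) G"
    by simp
  then show ?case by simp
qed

lemma bad_sw_low: "adm s i \<Longrightarrow> s \<le> r \<Longrightarrow> bad r (sw s i \<tau>) k \<longleftrightarrow> bad r \<tau> k"
  by (simp add: bad_def hit_sw_low)

lemma bad_bound:
  assumes "bad r \<tau> i"
  shows "i \<in> cols 0"
  using assms by (simp add: bad_def adm_def cols_def)

text \<open>\<open>wt_quad\<close> is invariant only under a swap in both rows. The missing swap in
  row \<open>m\<close> is free, because the sum over the rows below is symmetric there and
  \<open>G\<close> does not notice it. The support condition supplies the hits required by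
  \<open>wt_quad_sw_sw\<close>.\<close>

lemma exchange_wt_quad:
  assumes m: "1 \<le> m" and adm: "adm (Suc m) i" and sym: "symbelow (Suc m) G"
    and supp: "\<And>\<tau>. \<tau> \<in> F \<Longrightarrow> G \<tau> \<noteq> 0 \<Longrightarrow> bad m \<tau> i"
  shows "sum_quinv m (\<lambda>\<tau>. wt_quad m \<tau> * G (sw (Suc m) i \<tau>)) = sum_quinv m (\<lambda>\<tau>. wt_quad m \<tau> * G \<tau>)"
proof -
  let ?s = "sw m i" and ?s' = "sw (Suc m) i"
  have G: "G (?s \<tau>) = G \<tau>" if "\<tau> \<in> F" for \<tau>
    using symbelowD[OF sym m _ adm that] by simp
  have "symbelow m (\<lambda>\<tau>. wt_quad m (?s' \<tau>) * G \<tau>)"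
    by (intro symbelow_mult symbelow_sw[OF symbelow_wt_quad] symbelow_mono[OF sym]) (use adm in auto)
  from sum_quinv_sw[OF m adm_Suc[OF adm] this]
  have "sum_quinv m (\<lambda>\<tau>. wt_quad m (?s' \<tau>) * G \<tau>) = sum_quinv m (\<lambda>\<tau>. wt_quad m (?s' (?s \<tau>)) * G \<tau>)"
    using sum_quinv_cong[of "\<lambda>\<tau>. wt_quad m (?s' (?s \<tau>)) * G (?s \<tau>)" "\<lambda>\<tau>. wt_quad m (?s' (?s \<tau>)) * G \<tau>" m] G
    by simp
  also have "\<dots> = sum_quinv m (\<lambda>\<tau>. wt_quad m \<tau> * G \<tau>)"
  proof (intro sum_quinv_cong)
    fix \<tau> assume "\<tau> \<in> F"
    show "wt_quad m (?s' (?s \<tau>)) * G \<tau> = wt_quad m \<tau> * G \<tau>"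
    proof (cases "G \<tau> = 0")
      case False
      with supp \<open>\<tau> \<in> F\<close> have "bad m \<tau> i" by blast
      then show ?thesis
        using wt_quad_sw_sw[OF adm m, of \<tau>] by (simp add: bad_def sw_commute[of m "Suc m"])
    qed simp
  qed
  finally show ?thesis
    using sum_quinv_reindex[of m "Suc m" i "\<lambda>\<tau>. wt_quad m (?s' \<tau>) * G \<tau>"] adm by (simp add: sw_sw)
qed

lemma exchange_wt_quinv:
  assumes m: "1 \<le> m" and adm: "adm (Suc m) i" and sym: "symbelow (Suc m) G"
  shows "sum_quinv m (\<lambda>\<tau>. wt_quinv m \<tau> * G (sw (Suc m) i \<tau>)) = sum_quinv m (\<lambda>\<tau>. wt_quinv m \<tau> * G \<tau>)"
  using sum_quinv_sw[OF _ adm sym] m by (simp add: sum_quinv_Suc)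

text \<open>Induction on a bound for \<open>hitpos\<close> on the support of \<open>G\<close>. On
  sorted fillings the weights agree pointwise; on the others a swap at a bad position changes
  neither sum and lowers \<open>hitpos\<close>.\<close>

lemma sum_quinv_wt_quinv_eq_wt_quad:
  assumes m: "1 \<le> m" and sym: "symbelow (Suc m) G"
    and supp: "\<And>\<tau>. \<tau> \<in> F \<Longrightarrow> G \<tau> \<noteq> 0 \<Longrightarrow> hitpos m \<tau> < n"
  shows "sum_quinv m (\<lambda>\<tau>. wt_quinv m \<tau> * G \<tau>) = sum_quinv m (\<lambda>\<tau>. wt_quad m \<tau> * G \<tau>)"
  using sym supp
proof (induction n arbitrary: G)
  case 0
  then have "G \<tau> = 0" if "\<tau> \<in> F" for \<tau> using that by blast
  then show ?case by (intro sum_quinv_cong) simp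
next
  case (Suc n)
  \<comment> \<open>Choosing the least bad position splits \<open>G\<close> into a sorted part and
    one part for each position.\<close>
  define ix where "ix \<tau> = (LEAST i. bad m \<tau> i)" for \<tau>
  define G0 where "G0 \<tau> = (if \<exists>i. bad m \<tau> i then 0 else G \<tau>)" for \<tau>
  define G1 where "G1 i \<tau> = (if bad m \<tau> i \<and> ix \<tau> = i then G \<tau> else 0)" for i \<tau>
  have split: "G \<tau> = G0 \<tau> + (\<Sum>i\<in>cols 0. G1 i \<tau>)" for \<tau>
  proof (cases "\<exists>i. bad m \<tau> i")
    case True
    then have b: "bad m \<tau> (ix \<tau>)" unfolding ix_def by (rule LeastI_ex)
    have "(\<Sum>i\<in>cols 0. G1 i \<tau>) = (\<Sum>i\<in>{ix \<tau>}. G1 i \<tau>)"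
      by (intro sum.mono_neutral_right finite_cols) (use bad_bound[OF b] in \<open>auto simp: G1_def\<close>)
    then show ?thesis using True b by (simp add: G0_def G1_def)
  next
    case False
    then show ?thesis by (simp add: G0_def G1_def)
  qed
  \<comment> \<open>Swaps below row \<open>Suc m\<close> do not change which positions are bad, so
    each part inherits the symmetry of \<open>G\<close>.\<close>
  have ixs: "ix (sw r i \<tau>) = ix \<tau>" if "r < Suc m" "adm (Suc r) i" for r i \<tau>
    using that by (simp add: ix_def bad_sw_low adm_Suc)
  have sym1: "symbelow (Suc m) (G1 i)" for i
    using Suc.prems(1) unfolding symbelow_def G1_def by (auto simp: ixs bad_sw_low adm_Suc)
  have eq0: "sum_quinv m (\<lambda>\<tau>. wt_quinv m \<tau> * G0 \<tau>) = sum_quinv m (\<lambda>\<tau>. wt_quad m \<tau> * G0 \<tau>)"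
  proof (intro sum_quinv_cong)
    fix \<tau> assume "\<tau> \<in> F"
    then show "wt_quinv m \<tau> * G0 \<tau> = wt_quad m \<tau> * G0 \<tau>"
      using wt_quinv_eq_wt_quad_if_sorted[OF _ m distF] by (cases "\<exists>i. bad m \<tau> i") (auto simp: G0_def)
  qed
  have eq1: "sum_quinv m (\<lambda>\<tau>. wt_quinv m \<tau> * G1 i \<tau>) = sum_quinv m (\<lambda>\<tau>. wt_quad m \<tau> * G1 i \<tau>)" for i
  proof (cases "adm (Suc m) i")
    case True
    \<comment> \<open>The support of the swapped part consists of fillings obtained by sorting at
      \<open>i\<close>, so the induction hypothesis applies to it.\<close>
    let ?G = "\<lambda>\<tau>. G1 i (sw (Suc m) i \<tau>)"
    have "sum_quinv m (\<lambda>\<tau>. wt_quinv m \<tau> * ?G \<tau>) = sum_quinv m (\<lambda>\<tau>. wt_quad m \<tau> * ?G \<tau>)"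
    proof (rule Suc.IH)
      show "symbelow (Suc m) ?G" by (intro symbelow_sw sym1) (use True in auto)
      fix \<tau> assume "\<tau> \<in> F" "?G \<tau> \<noteq> 0"
      then have b: "bad m (sw (Suc m) i \<tau>) i" and "G (sw (Suc m) i \<tau>) \<noteq> 0"
        by (auto simp: G1_def split: if_splits)
      moreover have "sw (Suc m) i \<tau> \<in> F" using swF True \<open>\<tau> \<in> F\<close> by simp
      ultimately have "hitpos m (sw (Suc m) i \<tau>) < Suc n" using Suc.prems(2) by blast
      with hitpos_sw[OF b] show "hitpos m \<tau> < n" by (simp add: sw_sw)
    qed
    moreover have "bad m \<tau> i" if "G1 i \<tau> \<noteq> 0" for \<tau> using that by (auto simp: G1_def split: if_splits)
    ultimately show ?thesis
      using exchange_wt_quinv[OF m True sym1, of i] exchange_wt_quad[OF m True sym1, of i] by simp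
  next
    case False
    then have "G1 i = (\<lambda>_. 0)" by (auto simp: G1_def bad_def)
    then show ?thesis by simp
  qed
  show ?case
    unfolding split[of _] distrib_left sum_distrib_left sum_quinv_add sum_quinv_sum eq0 eq1 ..
qed

text \<open>The weights are exchanged one pair of rows at a time from the top. Once exchanged,
  \<open>wt_quad m\<close> joins the test function; it involves only the rows \<open>m\<close> and
  \<open>Suc m\<close> and so is symmetric below \<open>m\<close>.\<close>

lemma sum_quinv_eq_sum_quad:
  assumes "1 \<le> m" "symbelow m G"
  shows "sum_quinv m G = sum_quad m G"
  using assms
proof (induction m arbitrary: G rule: dec_induct)
  case base
  show ?case by (simp add: sum_quinv_def sum_quad_def)
next
  case (step m)
  \<comment> \<open>Finiteness of \<open>F\<close> provides the bound that starts the induction on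
    \<open>hitpos\<close>.\<close>
  have "hitpos m \<tau> < Suc (Max (hitpos m ` F))" if "\<tau> \<in> F" for \<tau>
    using that finF by (simp add: less_Suc_eq_le)
  then have "sum_quinv (Suc m) G = sum_quinv m (\<lambda>\<tau>. wt_quad m \<tau> * G \<tau>)"
    using sum_quinv_wt_quinv_eq_wt_quad[OF step.hyps(1) step.prems] step.hyps(1)
    by (simp add: sum_quinv_Suc) (metis (lifting))
  also have "\<dots> = sum_quad m (\<lambda>\<tau>. wt_quad m \<tau> * G \<tau>)"
    by (intro step.IH symbelow_mult symbelow_wt_quad symbelow_mono[OF step.prems]) simp
  also have "\<dots> = sum_quad (Suc m) G"
    using step.hyps by (simp add: sum_quad_def mult.assoc)
  finally show ?case .
qed

end

end

section \<open>Summation over signs\<close>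

lemma cmpI_neq: "labs a \<noteq> labs b \<Longrightarrow> cmpI (Letter a) (Letter b) \<longleftrightarrow> labs b < labs a"
  by (cases a; cases b) (auto simp: cmpI_def less_entry_def)

text \<open>A barred letter exceeds its unbarred version and compares as 1 with itself, so in a tie
  the sign of the first letter decides, whatever the sign of the second.\<close>

lemma cmpI_eq:
  assumes "labs a = labs b" "1 \<le> labs a"
  shows "cmpI (Letter a) (Letter b) \<longleftrightarrow> is_neg a"
  using assms by (cases a; cases b) (auto simp: cmpI_def less_entry_def Zminus_def alphabet_def)

text \<open>In a tie between a and b, exactly one of the two conditions involving c holds, so the
  triple counts iff \<open>I(a,b) = 0\<close>.\<close>

lemma Q3_letters:
  assumes "labs a \<noteq> labs c" "labs b \<noteq> labs c" "1 \<le> labs a"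
  shows "Q3 (Letter a) (Letter b) (Letter c) \<longleftrightarrow>
    (if labs a = labs b then \<not> is_neg a else cyc (labs a) (labs b) (labs c))"
proof (cases "labs a = labs b")
  case True
  have "cmpI (Letter a) (Letter b) \<longleftrightarrow> is_neg a"
    "cmpI (Letter c) (Letter b) \<longleftrightarrow> labs a < labs c"
    "cmpI (Letter a) (Letter c) \<longleftrightarrow> labs c < labs a"
    using assms True by (simp_all add: cmpI_eq cmpI_neq)
  then show ?thesis using True assms by (simp add: Q3_def)
next
  case False
  have "cmpI (Letter a) (Letter b) \<longleftrightarrow> labs b < labs a"
    "cmpI (Letter c) (Letter b) \<longleftrightarrow> labs b < labs c"
    "cmpI (Letter a) (Letter c) \<longleftrightarrow> labs c < labs a"
    using assms False by (simp_all add: cmpI_neq)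
  moreover have "\<not> labs b < labs c \<longleftrightarrow> labs c < labs b" "\<not> labs c < labs a \<longleftrightarrow> labs a \<le> labs c"
    using assms by auto
  ultimately show ?thesis using False by (simp add: Q3_def cyc_def)
qed

lemma Q3_top:
  assumes "labs b \<noteq> labs c"
  shows "Q3 Zero (Letter b) (Letter c) \<longleftrightarrow> labs b < labs c"
proof -
  have "\<not> cmpI Zero (Letter a)" for a by (cases a) (auto simp: cmpI_def less_entry_def)
  then show ?thesis using assms by (auto simp: Q3_def cmpI_neq)
qed

text \<open>Both conditions \<open>I(c,b) = 0\<close> and \<open>I(a,c) = 0\<close> hold, which is
  one too many.\<close>

lemma Q3_bottom: "\<not> Q3 a Infty Infty"
proof -
  have "\<not> cmpI a Infty" by (cases a rule: rank.cases) (auto simp: cmpI_def less_entry_def Zminus_def)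
  moreover have "\<not> cmpI Infty Infty" by (auto simp: cmpI_def Zminus_def)
  ultimately show ?thesis by (simp add: Q3_def)
qed

text \<open>As w and u differ in absolute value, case (2) of \<open>Q4\<close> cannot occur.\<close>

lemma Q4_letters:
  assumes "labs z \<noteq> labs w" "labs u \<noteq> labs v" "labs z \<noteq> labs v" "labs w \<noteq> labs u"
    and "1 \<le> labs z" "1 \<le> labs w"
  shows "Q4 (Letter z) (Letter w) (Letter u) (Letter v) \<longleftrightarrow>
    (if labs w = labs v \<and> labs z \<noteq> labs u then \<not> is_neg w
     else if labs z = labs u then \<not> is_neg z else cyc (labs z) (labs u) (labs v))"
  using assms Q3_letters[of z v u] by (auto simp: Q4_def Zplus_def alphabet_def)

lemma Q4_top:
  assumes "labs u \<noteq> labs v" "1 \<le> labs u" "1 \<le> labs v"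
  shows "Q4 Zero Zero (Letter u) (Letter v) \<longleftrightarrow> labs u < labs v"
  using assms Q3_top[of u v] by (auto simp: Q4_def zero_enat_def)

lemma Q4_bottom:
  assumes "z \<noteq> Infty" "w \<noteq> Infty"
  shows "\<not> Q4 z w Infty Infty"
  using assms Q3_bottom by (cases w) (auto simp: Q4_def zero_enat_def)

section \<open>Sums and cardinalities level by level\<close>

definition top_level :: nat where
  "top_level = Suc (ht 1)"

text \<open>Column 1 is the tallest. The \<open>Suc\<close> in \<open>top_level\<close> keeps it
  positive for the empty diagram.\<close>

lemma ht_less_top_level: "1 \<le> j \<Longrightarrow> ht j < top_level"
  using colht_antimono[of 1 j lam] by (simp add: top_level_def less_Suc_eq_le)

lemma prod_dg:
  fixes f :: "nat \<times> nat \<Rightarrow> 'a::comm_monoid_mult"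
  shows "(\<Prod>z\<in>dg lam. f z) = (\<Prod>r<top_level. \<Prod>j\<in>cols r. f (Suc r, j))"
proof -
  have "(\<Prod>r<top_level. \<Prod>j\<in>cols r. f (Suc r, j)) =
      (\<Prod>(r, j)\<in>Sigma {..<top_level} (cols). f (Suc r, j))"
    by (rule prod.Sigma) (auto simp: finite_cols)
  also have "\<dots> = (\<Prod>z\<in>dg lam. f z)"
    by (rule prod.reindex_bij_witness[of _ "\<lambda>(i, j). (i - 1, j)" "\<lambda>(r, j). (Suc r, j)"])
      (auto simp: dg_def cols_def dest: ht_less_top_level[unfolded One_nat_def])
  finally show ?thesis ..
qed

lemma sum_dg:
  fixes f :: "nat \<times> nat \<Rightarrow> 'a::comm_monoid_add"
  shows "(\<Sum>z\<in>dg lam. f z) = (\<Sum>r<top_level. \<Sum>j\<in>cols r. f (Suc r, j))"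
proof -
  have "(\<Sum>r<top_level. \<Sum>j\<in>cols r. f (Suc r, j)) =
      (\<Sum>(r, j)\<in>Sigma {..<top_level} (cols). f (Suc r, j))"
    by (rule sum.Sigma) (auto simp: finite_cols)
  also have "\<dots> = (\<Sum>z\<in>dg lam. f z)"
    by (rule sum.reindex_bij_witness[of _ "\<lambda>(i, j). (i - 1, j)" "\<lambda>(r, j). (Suc r, j)"])
      (auto simp: dg_def cols_def dest: ht_less_top_level[unfolded One_nat_def])
  finally show ?thesis ..
qed

lemma card_triples:
  assumes "\<And>r j k. (r, j, k) \<in> X \<Longrightarrow> 1 \<le> r \<and> j \<in> cols r"
    and fin: "\<And>r j. 1 \<le> r \<Longrightarrow> finite {k. (r, j, k) \<in> X}"
  shows "finite X" "card X = (\<Sum>r = 1..<top_level. \<Sum>j\<in>cols r. card {k. (r, j, k) \<in> X})"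
proof -
  have X: "X = Sigma {1..<top_level} (\<lambda>r. Sigma (cols r) (\<lambda>j. {k. (r, j, k) \<in> X}))"
  proof -
    have "1 \<le> r \<and> r < top_level \<and> j \<in> cols r" if "(r, j, k) \<in> X" for r j k
      using assms(1)[OF that] ht_less_top_level[of j] by (simp add: cols_def)
    then show ?thesis by auto
  qed
  have fin': "finite (Sigma (cols r) (\<lambda>j. {k. (r, j, k) \<in> X}))" if "1 \<le> r" for r
    using that fin finite_cols by (intro finite_SigmaI) auto
  show "finite X" by (subst X) (intro finite_SigmaI fin', auto)
  show "card X = (\<Sum>r = 1..<top_level. \<Sum>j\<in>cols r. card {k. (r, j, k) \<in> X})"
    by (subst X) (use fin fin' finite_cols in \<open>simp add: card_SigmaI\<close>)
qed

text \<open>Counting by the last column serves the quadruples that are charged to the box of their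
  upper right entry.\<close>

lemma card_triples_swap:
  assumes "\<And>r j k. (r, j, k) \<in> X \<Longrightarrow> 1 \<le> r \<and> k \<in> cols r \<and> j < k"
  shows "finite X" "card X = (\<Sum>r = 1..<top_level. \<Sum>k\<in>cols r. card {j. (r, j, k) \<in> X})"
proof -
  let ?s = "\<lambda>(r :: nat, j :: nat, k :: nat). (r, k, j)"
  have inj: "inj ?s" by (auto simp: inj_def)
  have mem: "(r, k, j) \<in> ?s ` X \<longleftrightarrow> (r, j, k) \<in> X" for r j k by force
  have 1: "1 \<le> r \<and> k \<in> cols r" if "(r, k, j) \<in> ?s ` X" for r k j
    using that assms unfolding mem by blast
  have 2: "finite {j. (r, k, j) \<in> ?s ` X}" for r k
    by (rule finite_subset[of _ "{..<k}"]) (use assms in \<open>auto\<close>)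
  have card: "card (?s ` X) = card X" by (rule card_image) (rule inj_on_subset[OF inj], simp)
  show "finite X" 
    by (rule finite_imageD[OF card_triples(1)[OF 1 2]]) (auto simp: inj_on_def)
  show "card X = (\<Sum>r = 1..<top_level. \<Sum>k\<in>cols r. card {j. (r, j, k) \<in> X})"
    using card_triples(2)[OF 1 2] unfolding card mem .
qed

text \<open>These are the triples with a = 0: then column j ends in row r, and
  \<open>c \<noteq> 0\<close> makes column k end there too. They do not depend on signs.\<close>

definition top_inv :: "(nat \<times> nat \<Rightarrow> nat) \<Rightarrow> (nat \<times> nat \<times> nat) set" where
  "top_inv \<tau> = {(r, j, k). 1 \<le> r \<and> 1 \<le> j \<and> j < k \<and> ht j = r \<and> ht k = r \<and> \<tau> (r, j) < \<tau> (r, k)}"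

lemma finite_top_inv: "finite (top_inv \<tau>)"
proof (rule finite_subset)
  show "top_inv \<tau> \<subseteq> (\<lambda>((r, j), (r', k)). (r, j, k)) ` (dg lam \<times> dg lam)"
    by (force simp: top_inv_def dg_def image_iff)
qed (simp add: finite_dg)

section \<open>Statistics of the super fillings with given absolute values\<close>

definition lifts :: "(nat \<times> nat \<Rightarrow> nat) \<Rightarrow> (nat \<times> nat \<Rightarrow> letter) set" where
  "lifts \<tau> = (\<Pi>\<^sub>E z\<in>dg lam. {Pos (\<tau> z), Neg (\<tau> z)})"

lemma labs_lifts: "\<sigma> \<in> lifts \<tau> \<Longrightarrow> z \<in> dg lam \<Longrightarrow> labs (\<sigma> z) = \<tau> z"
  using PiE_mem[of \<sigma> "dg lam" "\<lambda>z. {Pos (\<tau> z), Neg (\<tau> z)}" z] by (auto simp: lifts_def)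

lemma dg_iff: "(i, j) \<in> dg lam \<longleftrightarrow> 1 \<le> j \<and> 1 \<le> i \<and> i \<le> ht j"
  by (simp add: dg_def)

lemma quinv_triples_lifts:
  assumes \<sigma>: "\<sigma> \<in> lifts \<tau>" and pos: "\<And>z. z \<in> dg lam \<Longrightarrow> 1 \<le> \<tau> z"
    and dist: "rowdist \<tau>" and na: "\<And>r. 1 \<le> r \<Longrightarrow> lev_quinv_na r \<tau>"
  shows "(r, j, k) \<in> quinv_triples lam \<sigma> \<longleftrightarrow> (r, j, k) \<in> top_inv \<tau> \<or>
     1 \<le> r \<and> j \<in> cols r \<and> k \<in> right r j \<and>
       (if \<tau> (Suc r, j) = \<tau> (r, j) then \<not> is_neg (\<sigma> (Suc r, j))
        else cyc (\<tau> (Suc r, j)) (\<tau> (r, j)) (\<tau> (r, k)))"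
proof (cases "1 \<le> r \<and> 1 \<le> j \<and> j < k \<and> r \<le> ht j \<and> r \<le> ht k")
  case True
  then have u: "labs (\<sigma> (r, j)) = \<tau> (r, j)" and v: "labs (\<sigma> (r, k)) = \<tau> (r, k)"
    by (auto intro!: labs_lifts[OF \<sigma>] simp: dg_iff)
  have uv: "\<tau> (r, j) \<noteq> \<tau> (r, k)"
    using rowdistD[OF dist, of r j k] True by auto
  show ?thesis
  proof (cases "r = ht j")
    case top: True
    have "ht k = r" using True top colht_antimono[of j k lam] by simp
    then show ?thesis using True top uv Q3_top[of "\<sigma> (r, j)" "\<sigma> (r, k)", unfolded u v]
      by (auto simp: quinv_triples_def augdg_def top_inv_def cols_def)
  next
    case False
    then have z: "labs (\<sigma> (Suc r, j)) = \<tau> (Suc r, j)" "1 \<le> \<tau> (Suc r, j)"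
      using True labs_lifts[OF \<sigma>] pos by (simp_all add: dg_iff)
    have "\<tau> (Suc r, j) \<noteq> \<tau> (r, k)"
      using lev_naD[OF na, of r j k] True False by simp
    then show ?thesis using True False uv Q3_letters[of "\<sigma> (Suc r, j)" "\<sigma> (r, k)" "\<sigma> (r, j)"] z
      by (auto simp: quinv_triples_def augdg_def top_inv_def cols_def right_def u v)
  qed
next
  case False
  \<comment> \<open>Row 0 contributes nothing by \<open>Q3_bottom\<close>, and a column ending just
    below row r is ruled out by the condition that c is not 0.\<close>
  have "(r, j, k) \<notin> quinv_triples lam \<sigma>"
  proof
    assume a: "(r, j, k) \<in> quinv_triples lam \<sigma>"
    show False
    proof (cases "r = 0")
      case True
      then show False using a Q3_bottom by (simp add: quinv_triples_def)
    next
      case r: False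
      then have "r \<noteq> Suc (ht k)" using a by (auto simp: quinv_triples_def)
      then show False using a False r by (auto simp: quinv_triples_def augdg_def)
    qed
  qed
  then show ?thesis using False by (auto simp: top_inv_def cols_def right_def)
qed

definition cnt_quinv :: "(nat \<times> nat \<Rightarrow> nat) \<Rightarrow> nat \<Rightarrow> nat \<Rightarrow> bool \<Rightarrow> nat" where
  "cnt_quinv \<tau> r j s = card {k \<in> right r j. if \<tau> (Suc r, j) = \<tau> (r, j) then \<not> s
        else cyc (\<tau> (Suc r, j)) (\<tau> (r, j)) (\<tau> (r, k))}"

text \<open>Every triple outside \<open>top_inv\<close> is charged to the box of a, the only box
  whose sign can matter.\<close>

lemma quinv_lifts:
  assumes \<sigma>: "\<sigma> \<in> lifts \<tau>" and pos: "\<And>z. z \<in> dg lam \<Longrightarrow> 1 \<le> \<tau> z"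
    and dist: "rowdist \<tau>" and na: "\<And>r. 1 \<le> r \<Longrightarrow> lev_quinv_na r \<tau>"
  shows "quinv lam \<sigma> = card (top_inv \<tau>) +
    (\<Sum>r = 1..<top_level. \<Sum>j\<in>cols r. cnt_quinv \<tau> r j (is_neg (\<sigma> (Suc r, j))))"
proof -
  define X where "X = {(r, j, k). 1 \<le> r \<and> j \<in> cols r \<and> k \<in> right r j \<and>
       (if \<tau> (Suc r, j) = \<tau> (r, j) then \<not> is_neg (\<sigma> (Suc r, j))
        else cyc (\<tau> (Suc r, j)) (\<tau> (r, j)) (\<tau> (r, k)))}"
  have 1: "1 \<le> r \<and> j \<in> cols r" if "(r, j, k) \<in> X" for r j k
    using that by (simp add: X_def)
  have 2: "finite {k. (r, j, k) \<in> X}" if "1 \<le> r" for r j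
    by (rule finite_subset[OF _ finite_right[OF that, of j]]) (auto simp: X_def)
  have "quinv_triples lam \<sigma> = top_inv \<tau> \<union> X"
  proof -
    have "(r, j, k) \<in> quinv_triples lam \<sigma> \<longleftrightarrow> (r, j, k) \<in> top_inv \<tau> \<union> X" for r j k
      unfolding quinv_triples_lifts[OF assms, simplified] by (simp add: X_def)
    then show ?thesis by auto
  qed
  moreover have "top_inv \<tau> \<inter> X = {}" by (auto simp: X_def top_inv_def cols_def)
  ultimately have "quinv lam \<sigma> = card (top_inv \<tau>) + card X"
    by (simp add: quinv_def card_Un_disjoint finite_top_inv card_triples(1)[OF 1 2])
  also have "card X = (\<Sum>r = 1..<top_level. \<Sum>j\<in>cols r. card {k. (r, j, k) \<in> X})"
    by (rule card_triples(2)[OF 1 2])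
  also have "\<dots> = (\<Sum>r = 1..<top_level. \<Sum>j\<in>cols r. cnt_quinv \<tau> r j (is_neg (\<sigma> (Suc r, j))))"
    unfolding cnt_quinv_def by (intro sum.cong refl arg_cong[of _ _ card]) (auto simp: X_def)
  finally show ?thesis .
qed

lemma lev_quinv_na_if_lev_quad_na: "lev_quad_na r \<tau> \<Longrightarrow> lev_quinv_na r \<tau>"
  unfolding lev_quinv_na_def
  by (intro allI impI) (rule lev_qnaD, auto intro: colht_antimono)

lemma quadcoinv_quadruples_lifts:
  assumes \<sigma>: "\<sigma> \<in> lifts \<tau>" and pos: "\<And>z. z \<in> dg lam \<Longrightarrow> 1 \<le> \<tau> z"
    and dist: "rowdist \<tau>" and na: "\<And>r. 1 \<le> r \<Longrightarrow> lev_quad_na r \<tau>"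
  shows "(r, j, k) \<in> quadcoinv_quadruples lam \<sigma> \<longleftrightarrow> (r, j, k) \<in> top_inv \<tau> \<or>
     1 \<le> r \<and> j \<in> cols r \<and> k \<in> right r j \<and> ht j = ht k \<and>
       (if \<tau> (Suc r, k) = \<tau> (r, k) \<and> \<tau> (Suc r, j) \<noteq> \<tau> (r, j) then \<not> is_neg (\<sigma> (Suc r, k))
        else if \<tau> (Suc r, j) = \<tau> (r, j) then \<not> is_neg (\<sigma> (Suc r, j))
        else cyc (\<tau> (Suc r, j)) (\<tau> (r, j)) (\<tau> (r, k)))"
proof (cases "1 \<le> r \<and> 1 \<le> j \<and> j < k \<and> r \<le> ht j \<and> ht k = ht j")
  case True
  then have u: "labs (\<sigma> (r, j)) = \<tau> (r, j)" "1 \<le> \<tau> (r, j)"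
    and v: "labs (\<sigma> (r, k)) = \<tau> (r, k)" "1 \<le> \<tau> (r, k)"
    using labs_lifts[OF \<sigma>] pos by (simp_all add: dg_iff)
  have uv: "\<tau> (r, j) \<noteq> \<tau> (r, k)"
    using rowdistD[OF dist, of r j k] True by auto
  show ?thesis
  proof (cases "r = ht j")
    case top: True
    then show ?thesis using True uv u v Q4_top[of "\<sigma> (r, j)" "\<sigma> (r, k)", unfolded u v]
      by (auto simp: quadcoinv_quadruples_def augdg_def top_inv_def cols_def)
  next
    case False
    then have z: "labs (\<sigma> (Suc r, j)) = \<tau> (Suc r, j)" "1 \<le> \<tau> (Suc r, j)"
      and w: "labs (\<sigma> (Suc r, k)) = \<tau> (Suc r, k)" "1 \<le> \<tau> (Suc r, k)"
      using True labs_lifts[OF \<sigma>] pos by (simp_all add: dg_iff)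
    have ne: "\<tau> (Suc r, j) \<noteq> \<tau> (r, k)" "\<tau> (Suc r, k) \<noteq> \<tau> (r, j)"
      using lev_qnaD[OF na, of r j k] lev_qnaD[OF na, of r k j] True False by simp_all
    have zw: "\<tau> (Suc r, j) \<noteq> \<tau> (Suc r, k)"
      using rowdistD[OF dist, of "Suc r" j k] True False by auto
    have "(r, j, k) \<in> quadcoinv_quadruples lam \<sigma> \<longleftrightarrow>
        Q4 (Letter (\<sigma> (Suc r, j))) (Letter (\<sigma> (Suc r, k))) (Letter (\<sigma> (r, j))) (Letter (\<sigma> (r, k)))"
      using True False by (auto simp: quadcoinv_quadruples_def augdg_def)
    also have "\<dots> \<longleftrightarrow> (if \<tau> (Suc r, k) = \<tau> (r, k) \<and> \<tau> (Suc r, j) \<noteq> \<tau> (r, j) then \<not> is_neg (\<sigma> (Suc r, k))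
        else if \<tau> (Suc r, j) = \<tau> (r, j) then \<not> is_neg (\<sigma> (Suc r, j))
        else cyc (\<tau> (Suc r, j)) (\<tau> (r, j)) (\<tau> (r, k)))"
      using Q4_letters[of "\<sigma> (Suc r, j)" "\<sigma> (Suc r, k)" "\<sigma> (r, j)" "\<sigma> (r, k)"]
      unfolding u v z w using uv ne zw z(2) w(2) by simp
    finally show ?thesis using True False by (simp add: top_inv_def cols_def right_def)
  qed
next
  case False
  have "(r, j, k) \<notin> quadcoinv_quadruples lam \<sigma>"
  proof
    assume a: "(r, j, k) \<in> quadcoinv_quadruples lam \<sigma>"
    show False
    proof (cases "r = 0")
      case True
      then show False using a Q4_bottom[of "aug lam \<sigma> (1, j)" "aug lam \<sigma> (1, k)"]
        by (auto simp: quadcoinv_quadruples_def)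
    next
      case r: False
      then show False using a False r by (auto simp: quadcoinv_quadruples_def augdg_def)
    qed
  qed
  then show ?thesis using False by (auto simp: top_inv_def cols_def right_def)
qed

text \<open>The second cardinality collects the case (1) quadruples having this box as upper right
  entry. In this way each count depends on the sign of a single box.\<close>

definition cnt_quad :: "(nat \<times> nat \<Rightarrow> nat) \<Rightarrow> nat \<Rightarrow> nat \<Rightarrow> bool \<Rightarrow> nat" where
  "cnt_quad \<tau> r j s =
     card {k \<in> right r j. if \<tau> (Suc r, j) = \<tau> (r, j) then \<not> s
        else cyc (\<tau> (Suc r, j)) (\<tau> (r, j)) (\<tau> (r, k)) \<and>
          \<not> (ht k = ht j \<and> \<tau> (Suc r, k) = \<tau> (r, k))} +
     card {i. 1 \<le> i \<and> i < j \<and> ht i = ht j \<and> \<tau> (Suc r, i) \<noteq> \<tau> (r, i) \<and>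
        \<tau> (Suc r, j) = \<tau> (r, j) \<and> \<not> s}"

text \<open>Apart from the top inversions, \<open>X\<close> gathers what is decided at the upper
  left box, over columns of equal and of unequal height alike, and \<open>Y\<close> what is decided
  by the sign of the upper right box.\<close>

lemma quadcoinv_lifts:
  assumes \<sigma>: "\<sigma> \<in> lifts \<tau>" and pos: "\<And>z. z \<in> dg lam \<Longrightarrow> 1 \<le> \<tau> z"
    and dist: "rowdist \<tau>" and na: "\<And>r. 1 \<le> r \<Longrightarrow> lev_quad_na r \<tau>"
  shows "quadcoinv lam \<sigma> = card (top_inv \<tau>) +
    (\<Sum>r = 1..<top_level. \<Sum>j\<in>cols r. cnt_quad \<tau> r j (is_neg (\<sigma> (Suc r, j))))"
proof -
  define T where "T r j k \<longleftrightarrow> (if \<tau> (Suc r, j) = \<tau> (r, j) then \<not> is_neg (\<sigma> (Suc r, j))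
        else cyc (\<tau> (Suc r, j)) (\<tau> (r, j)) (\<tau> (r, k)))" for r j k
  \<comment> \<open>\<open>E\<close> marks case (1) of \<open>Q4\<close>. It requires equal heights,
    so for unequal heights \<open>X\<close> contains all triples.\<close>
  define E where "E r j k \<longleftrightarrow> ht j = ht k \<and> \<tau> (Suc r, k) = \<tau> (r, k) \<and> \<tau> (Suc r, j) \<noteq> \<tau> (r, j)" for r j k
  define X where "X = {(r, j, k). 1 \<le> r \<and> j \<in> cols r \<and> k \<in> right r j \<and> T r j k \<and> \<not> E r j k}"
  define Y where "Y = {(r, j, k). 1 \<le> r \<and> j \<in> cols r \<and> k \<in> right r j \<and> E r j k \<and>
      \<not> is_neg (\<sigma> (Suc r, k))}"
  have X1: "1 \<le> r \<and> j \<in> cols r" if "(r, j, k) \<in> X" for r j k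
    using that by (simp add: X_def)
  have X2: "finite {k. (r, j, k) \<in> X}" if "1 \<le> r" for r j
    by (rule finite_subset[OF _ finite_right[OF that, of j]]) (auto simp: X_def)
  have Y1: "1 \<le> r \<and> k \<in> cols r \<and> j < k" if "(r, j, k) \<in> Y" for r j k
    using that by (auto simp: Y_def cols_def right_def E_def)
  note finX = card_triples(1)[OF X1 X2]
  note finY = card_triples_swap(1)[OF Y1]
  define X' where "X' = {(r, j, k) \<in> X. ht j = ht k}"
  define X'' where "X'' = {(r, j, k) \<in> X. ht j > ht k}"
  have fin: "finite X'" "finite X''" 
    by (rule finite_subset[OF _ finX]; auto simp: X'_def X''_def)+
  have "ht k \<le> ht j" if "(r, j, k) \<in> X" for r j k
    using that right_ht[of k r j] by (auto simp: X_def)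
  then have X: "X = X' \<union> X''" by (force simp: X'_def X''_def)
  have "quadcoinv_quadruples lam \<sigma> = top_inv \<tau> \<union> (X' \<union> Y)"
  proof -
    have "(r, j, k) \<in> quadcoinv_quadruples lam \<sigma> \<longleftrightarrow> (r, j, k) \<in> top_inv \<tau> \<union> (X' \<union> Y)" for r j k
    proof -
      have "(r, j, k) \<in> quadcoinv_quadruples lam \<sigma> \<longleftrightarrow> (r, j, k) \<in> top_inv \<tau> \<or>
          1 \<le> r \<and> j \<in> cols r \<and> k \<in> right r j \<and> ht j = ht k \<and>
          (if \<tau> (Suc r, k) = \<tau> (r, k) \<and> \<tau> (Suc r, j) \<noteq> \<tau> (r, j)
           then \<not> is_neg (\<sigma> (Suc r, k)) else T r j k)"
        unfolding T_def by (rule quadcoinv_quadruples_lifts[OF assms])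
      then show ?thesis by (auto simp: X_def X'_def Y_def E_def)
    qed
    then show ?thesis by auto
  qed
  moreover have "top_inv \<tau> \<inter> (X' \<union> Y) = {}" "X' \<inter> Y = {}" "X' \<inter> X'' = {}"
    by (auto simp: X_def X'_def X''_def Y_def top_inv_def cols_def)
  moreover have "{(r, j, k) \<in> quinv_triples lam \<sigma>. ht j > ht k} = X''"
  proof -
    have "(r, j, k) \<in> quinv_triples lam \<sigma> \<and> ht j > ht k \<longleftrightarrow> (r, j, k) \<in> X''" for r j k
    proof -
      have "(r, j, k) \<in> quinv_triples lam \<sigma> \<longleftrightarrow> (r, j, k) \<in> top_inv \<tau> \<or>
          1 \<le> r \<and> j \<in> cols r \<and> k \<in> right r j \<and> T r j k"
        unfolding T_def by (rule quinv_triples_lifts[OF \<sigma> pos dist lev_quinv_na_if_lev_quad_na[OF na]])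
      moreover have "(r, j, k) \<in> top_inv \<tau> \<or> E r j k \<Longrightarrow> ht j = ht k"
        by (auto simp: top_inv_def E_def)
      ultimately show ?thesis by (auto simp: X_def X''_def)
    qed
    then show ?thesis by auto
  qed
  ultimately have "quadcoinv lam \<sigma> = card (top_inv \<tau>) + card X + card Y"
    using fin finY by (simp add: quadcoinv_def X card_Un_disjoint finite_top_inv)
  also have "\<dots> = card (top_inv \<tau>) + ((\<Sum>r = 1..<top_level. \<Sum>j\<in>cols r. card {k. (r, j, k) \<in> X}) +
      (\<Sum>r = 1..<top_level. \<Sum>j\<in>cols r. card {i. (r, i, j) \<in> Y}))"
    using card_triples(2)[OF X1 X2] card_triples_swap(2)[OF Y1] by simp
  also have "(\<Sum>r = 1..<top_level. \<Sum>j\<in>cols r. card {k. (r, j, k) \<in> X}) +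
      (\<Sum>r = 1..<top_level. \<Sum>j\<in>cols r. card {i. (r, i, j) \<in> Y}) =
      (\<Sum>r = 1..<top_level. \<Sum>j\<in>cols r. cnt_quad \<tau> r j (is_neg (\<sigma> (Suc r, j))))"
    unfolding sum.distrib[symmetric]
  proof (intro sum.cong refl)
    fix r j assume "r \<in> {1..<top_level}" "j \<in> cols r"
    then have rj: "1 \<le> r" "1 \<le> j" "j \<in> cols r" by (auto simp: cols_def)
    have "{k. (r, j, k) \<in> X} = {k \<in> right r j. if \<tau> (Suc r, j) = \<tau> (r, j)
        then \<not> is_neg (\<sigma> (Suc r, j))
        else cyc (\<tau> (Suc r, j)) (\<tau> (r, j)) (\<tau> (r, k)) \<and>
          \<not> (ht k = ht j \<and> \<tau> (Suc r, k) = \<tau> (r, k))}"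
      using rj by (cases "\<tau> (Suc r, j) = \<tau> (r, j)") (auto simp: X_def T_def E_def)
    moreover have "(r, i, j) \<in> Y \<longleftrightarrow> 1 \<le> i \<and> i < j \<and> ht i = ht j \<and>
        \<tau> (Suc r, i) \<noteq> \<tau> (r, i) \<and> \<tau> (Suc r, j) = \<tau> (r, j) \<and> \<not> is_neg (\<sigma> (Suc r, j))" for i
      using rj by (auto simp: Y_def E_def cols_def right_def)
    ultimately show "card {k. (r, j, k) \<in> X} + card {i. (r, i, j) \<in> Y} =
        cnt_quad \<tau> r j (is_neg (\<sigma> (Suc r, j)))"
      by (simp only: cnt_quad_def)
  qed
  finally show ?thesis .
qed

section \<open>Major index and factorisation of the sign sum\<close>

definition desc :: "(nat \<times> nat \<Rightarrow> nat) \<Rightarrow> nat \<Rightarrow> nat \<Rightarrow> bool \<Rightarrow> nat" where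
  "desc \<tau> r j s = (ht j - r) *
     of_bool (\<tau> (r, j) < \<tau> (Suc r, j) \<or> \<tau> (Suc r, j) = \<tau> (r, j) \<and> s)"

lemma leg_eq: "1 \<le> j \<Longrightarrow> leg lam (i, j) = ht j - i"
proof -
  assume "1 \<le> j"
  then have "{i'. i < i' \<and> (i', j) \<in> dg lam} = {i<..ht j}" by (auto simp: dg_iff)
  then show ?thesis by simp
qed

lemma maj_lifts:
  assumes \<sigma>: "\<sigma> \<in> lifts \<tau>" and pos: "\<And>z. z \<in> dg lam \<Longrightarrow> 1 \<le> \<tau> z"
  shows "maj lam \<sigma> = (\<Sum>r = 1..<top_level. \<Sum>j\<in>cols r. desc \<tau> r j (is_neg (\<sigma> (Suc r, j))))"
proof -
  let ?D = "\<lambda>z. fst z \<noteq> 1 \<and> cmpI (Letter (\<sigma> z)) (Letter (\<sigma> (South z)))"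
  have "maj lam \<sigma> = (\<Sum>z\<in>dg lam. if ?D z then leg lam z + 1 else 0)"
    unfolding maj_def by (simp add: sum.inter_filter[OF finite_dg, symmetric])
  also have "\<dots> = (\<Sum>r<top_level. \<Sum>j\<in>cols r. if ?D (Suc r, j) then leg lam (Suc r, j) + 1 else 0)"
    by (rule sum_dg)
  also have "\<dots> = (\<Sum>r = 1..<top_level. \<Sum>j\<in>cols r. if ?D (Suc r, j) then leg lam (Suc r, j) + 1 else 0)"
    by (rule sum.mono_neutral_right) (auto simp: not_le)
  also have "\<dots> = (\<Sum>r = 1..<top_level. \<Sum>j\<in>cols r. desc \<tau> r j (is_neg (\<sigma> (Suc r, j))))"
  proof (intro sum.cong refl)
    fix r j assume "r \<in> {1..<top_level}" "j \<in> cols r"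
    then have rj: "1 \<le> r" "1 \<le> j" "r < ht j" by (auto simp: cols_def)
    then have l: "labs (\<sigma> (Suc r, j)) = \<tau> (Suc r, j)" "labs (\<sigma> (r, j)) = \<tau> (r, j)"
      "1 \<le> \<tau> (Suc r, j)"
      using labs_lifts[OF \<sigma>] pos by (simp_all add: dg_iff)
    have "cmpI (Letter (\<sigma> (Suc r, j))) (Letter (\<sigma> (r, j))) \<longleftrightarrow>
       \<tau> (r, j) < \<tau> (Suc r, j) \<or> \<tau> (Suc r, j) = \<tau> (r, j) \<and> is_neg (\<sigma> (Suc r, j))"
      using cmpI_neq[of "\<sigma> (Suc r, j)" "\<sigma> (r, j)"] cmpI_eq[of "\<sigma> (Suc r, j)" "\<sigma> (r, j)"] l
      by (cases "\<tau> (Suc r, j) = \<tau> (r, j)") auto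
    then show "(if ?D (Suc r, j) then leg lam (Suc r, j) + 1 else 0) =
        desc \<tau> r j (is_neg (\<sigma> (Suc r, j)))"
      using rj by (simp add: desc_def leg_eq Suc_diff_Suc del: leg.simps)
  qed
  finally show ?thesis .
qed

definition boxwt :: "(nat \<times> nat \<Rightarrow> nat) \<Rightarrow> (nat \<Rightarrow> nat \<Rightarrow> bool \<Rightarrow> nat) \<Rightarrow> nat \<times> nat \<Rightarrow> bool \<Rightarrow> int poly poly"
  where "boxwt \<tau> c z s = (if s then - 1 else tvar) *
    (if fst z = 1 then 1 else qvar ^ desc \<tau> (fst z - 1) (snd z) s * tvar ^ c (fst z - 1) (snd z) s)"

text \<open>Each exponent is a constant plus a sum of terms depending on the sign of one box. The
  summand is therefore a product over boxes, and summing over all signs gives a product of two-term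
  sums; a box of the bottom row contributes t - 1.\<close>

lemma sign_sum:
  assumes pos: "\<And>z. z \<in> dg lam \<Longrightarrow> 1 \<le> \<tau> z"
    and stat: "\<And>\<sigma>. \<sigma> \<in> lifts \<tau> \<Longrightarrow> stat \<sigma> = n +
      (\<Sum>r = 1..<top_level. \<Sum>j\<in>cols r. c r j (is_neg (\<sigma> (Suc r, j))))"
  shows "(\<Sum>\<sigma>\<in>lifts \<tau>. (-1) ^ num_neg lam \<sigma> * qvar ^ maj lam \<sigma> * tvar ^ (num_pos lam \<sigma> + stat \<sigma>)) =
    tvar ^ n * (tvar - 1) ^ card (cols 0) *
     (\<Prod>r = 1..<top_level. \<Prod>j\<in>cols r. tvar * qvar ^ desc \<tau> r j False * tvar ^ c r j False
        - qvar ^ desc \<tau> r j True * tvar ^ c r j True)"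
proof -
  have tm: "(-1) ^ num_neg lam \<sigma> * qvar ^ maj lam \<sigma> * tvar ^ (num_pos lam \<sigma> + stat \<sigma>) =
      tvar ^ n * (\<Prod>z\<in>dg lam. boxwt \<tau> c z (is_neg (\<sigma> z)))" if \<sigma>: "\<sigma> \<in> lifts \<tau>" for \<sigma>
  proof -
    let ?s = "\<lambda>z. is_neg (\<sigma> z)"
    have "(\<Prod>z\<in>dg lam. boxwt \<tau> c z (?s z)) =
        (\<Prod>z\<in>dg lam. if ?s z then - 1 else tvar) *
        (\<Prod>z\<in>dg lam. if fst z = 1 then 1 else
           qvar ^ desc \<tau> (fst z - 1) (snd z) (?s z) * tvar ^ c (fst z - 1) (snd z) (?s z))"
      by (simp add: boxwt_def prod.distrib)
    also have "(\<Prod>z\<in>dg lam. if ?s z then - 1 else tvar) = (-1) ^ num_neg lam \<sigma> * tvar ^ num_pos lam \<sigma>"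
      by (simp add: prod.If_cases finite_dg num_neg_def num_pos_def Int_def Collect_neg_eq[symmetric])
    also have "(\<Prod>z\<in>dg lam. if fst z = 1 then 1 else
           qvar ^ desc \<tau> (fst z - 1) (snd z) (?s z) * tvar ^ c (fst z - 1) (snd z) (?s z)) =
        (\<Prod>r<top_level. \<Prod>j\<in>cols r. if r = 0 then 1 else
           qvar ^ desc \<tau> r j (?s (Suc r, j)) * tvar ^ c r j (?s (Suc r, j)))"
      by (subst prod_dg, intro prod.cong refl) simp
    also have "\<dots> = (\<Prod>r = 1..<top_level. \<Prod>j\<in>cols r.
           qvar ^ desc \<tau> r j (?s (Suc r, j)) * tvar ^ c r j (?s (Suc r, j)))"
      by (rule prod.mono_neutral_cong_right) auto
    also have "\<dots> = qvar ^ maj lam \<sigma> *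
        tvar ^ (\<Sum>r = 1..<top_level. \<Sum>j\<in>cols r. c r j (?s (Suc r, j)))"
      by (simp add: prod.distrib power_sum maj_lifts[OF \<sigma> pos])
    finally show ?thesis by (simp add: stat[OF \<sigma>] power_add)
  qed
  \<comment> \<open>Distributivity: a lift is an independent choice of sign in every box.\<close>
  have "(\<Prod>z\<in>dg lam. \<Sum>y\<in>{Pos (\<tau> z), Neg (\<tau> z)}. boxwt \<tau> c z (is_neg y)) =
      (\<Sum>\<sigma>\<in>lifts \<tau>. \<Prod>z\<in>dg lam. boxwt \<tau> c z (is_neg (\<sigma> z)))"
    unfolding lifts_def by (rule prod_sum_PiE) (auto simp: finite_dg)
  moreover have "(\<Prod>z\<in>dg lam. \<Sum>y\<in>{Pos (\<tau> z), Neg (\<tau> z)}. boxwt \<tau> c z (is_neg y)) =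
      (\<Prod>z\<in>dg lam. boxwt \<tau> c z False + boxwt \<tau> c z True)"
    by simp
  moreover have "\<dots> = (\<Prod>r<top_level. \<Prod>j\<in>cols r. boxwt \<tau> c (Suc r, j) False + boxwt \<tau> c (Suc r, j) True)"
    by (rule prod_dg)
  moreover have "{..<top_level} = insert 0 {1..<top_level}" by (auto simp: top_level_def)
  ultimately have "(\<Sum>\<sigma>\<in>lifts \<tau>. \<Prod>z\<in>dg lam. boxwt \<tau> c z (is_neg (\<sigma> z))) =
      (tvar - 1) ^ card (cols 0) *
      (\<Prod>r = 1..<top_level. \<Prod>j\<in>cols r. boxwt \<tau> c (Suc r, j) False + boxwt \<tau> c (Suc r, j) True)"
    by (simp add: boxwt_def)
  also have "(\<Prod>r = 1..<top_level. \<Prod>j\<in>cols r. boxwt \<tau> c (Suc r, j) False + boxwt \<tau> c (Suc r, j) True) =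
     (\<Prod>r = 1..<top_level. \<Prod>j\<in>cols r. tvar * qvar ^ desc \<tau> r j False * tvar ^ c r j False
        - qvar ^ desc \<tau> r j True * tvar ^ c r j True)"
    by (intro prod.cong refl) (auto simp: boxwt_def)
  finally show ?thesis using tm by (simp add: sum_distrib_left[symmetric] mult.assoc)
qed

text \<open>In a tie, the positive sign turns every column on the right into a triple and the
  negative sign makes a descent. Without a tie both signs give the same monomial, whence the factor
  t - 1.\<close>

lemma colfac_as_sign_sum:
  assumes "rowdist \<tau>" "1 \<le> r" "j \<in> cols r"
  shows "tvar * qvar ^ desc \<tau> r j False * tvar ^ cnt_quinv \<tau> r j False
        - qvar ^ desc \<tau> r j True * tvar ^ cnt_quinv \<tau> r j True =
    colfac (ht j - r) ((\<lambda>k. \<tau> (r, k)) ` right r j) (\<tau> (Suc r, j)) (\<tau> (r, j))"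
proof -
  have inj: "inj_on (\<lambda>k. \<tau> (r, k)) (right r j)"
    using rowdistD[OF assms(1), of r] assms(2,3) by (auto simp: inj_on_def right_def cols_def)
  then show ?thesis
    by (auto simp: desc_def cnt_quinv_def colfac_def card_image ncyc_image algebra_simps)
qed

lemma fac_quad_as_sign_sum:
  "tvar * qvar ^ desc \<tau> r j False * tvar ^ cnt_quad \<tau> r j False
        - qvar ^ desc \<tau> r j True * tvar ^ cnt_quad \<tau> r j True = fac_quad r \<tau> j"
proof (cases "\<tau> (Suc r, j) = \<tau> (r, j)")
  case True
  then show ?thesis by (simp add: desc_def cnt_quad_def fac_quad_def)
next
  case False
  then show ?thesis by (simp add: desc_def cnt_quad_def fac_quad_def algebra_simps)
qed

section \<open>Non-attacking conditions by pairs of consecutive rows\<close>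

lemma quinv_non_attacking_iff:
  "quinv_non_attacking lam \<tau> \<longleftrightarrow> rowdist \<tau> \<and> (\<forall>r\<in>{1..<top_level}. lev_quinv_na r \<tau>)"
proof
  assume q: "quinv_non_attacking lam \<tau>"
  have row: "u = v" if "u \<in> dg lam" "v \<in> dg lam" "\<tau> u = \<tau> v" "fst u = fst v" for u v
    using q that unfolding quinv_non_attacking_def by blast
  have diag: "\<tau> u \<noteq> \<tau> v" if "u \<in> dg lam" "v \<in> dg lam" "fst u = fst v + 1" "snd u < snd v" for u v
    using q that unfolding quinv_non_attacking_def by (metis less_irrefl)
  have "rowdist \<tau>"
    unfolding rowdist_def using row[of "(r, j)" "(r, k)" for r j k] by (auto simp: dg_iff)
  moreover have "lev_quinv_na r \<tau>" if "1 \<le> r" for r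
    unfolding lev_quinv_na_def using that diag[of "(Suc r, j)" "(r, k)" for j k] by (auto simp: dg_iff)
  ultimately show "rowdist \<tau> \<and> (\<forall>r\<in>{1..<top_level}. lev_quinv_na r \<tau>)" by simp
next
  assume a: "rowdist \<tau> \<and> (\<forall>r\<in>{1..<top_level}. lev_quinv_na r \<tau>)"
  have row: "j = k" if "(r, j) \<in> dg lam" "(r, k) \<in> dg lam" "\<tau> (r, j) = \<tau> (r, k)" for r j k
    using that a rowdistD[of \<tau> r j k] by (auto simp: dg_iff)
  have diag: "\<tau> (Suc r, j) \<noteq> \<tau> (r, k)" if "(Suc r, j) \<in> dg lam" "(r, k) \<in> dg lam" "j < k" for r j k
    using that a lev_naD[of r \<tau> j k] ht_less_top_level[of j] by (auto simp: dg_iff)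
  show "quinv_non_attacking lam \<tau>"
    unfolding quinv_non_attacking_def using row diag by fastforce
qed

lemma non_attacking_iff:
  "non_attacking lam \<tau> \<longleftrightarrow> rowdist \<tau> \<and> (\<forall>r\<in>{1..<top_level}. lev_quad_na r \<tau>)"
proof
  assume n: "non_attacking lam \<tau>"
  then have q: "rowdist \<tau>" "\<forall>r\<in>{1..<top_level}. lev_quinv_na r \<tau>"
    by (auto simp: non_attacking_def quinv_non_attacking_iff)
  have diag: "\<tau> u \<noteq> \<tau> v" if "u \<in> dg lam" "v \<in> dg lam" "fst u = fst v + 1" "snd v < snd u"
    "ht (snd u) = ht (snd v)" for u v
    using n that unfolding non_attacking_def by (metis less_irrefl)
  have "lev_quad_na r \<tau>" if r: "r \<in> {1..<top_level}" for r
    unfolding lev_quad_na_def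
  proof (intro allI impI)
    fix j k assume a: "1 \<le> j \<and> 1 \<le> k \<and> j \<noteq> k \<and> r < ht j \<and> r \<le> ht k \<and> ht k \<le> ht j"
    show "\<tau> (Suc r, j) \<noteq> \<tau> (r, k)"
    proof (cases "j < k")
      case True
      then show ?thesis using q(2) r a lev_naD[of r \<tau> j k] by blast
    next
      case False
      then have "k < j" "ht j = ht k" using a colht_antimono[of k j lam] by auto
      then show ?thesis using diag[of "(Suc r, j)" "(r, k)"] a r by (simp add: dg_iff)
    qed
  qed
  with q show "rowdist \<tau> \<and> (\<forall>r\<in>{1..<top_level}. lev_quad_na r \<tau>)" by simp
next
  assume a: "rowdist \<tau> \<and> (\<forall>r\<in>{1..<top_level}. lev_quad_na r \<tau>)"
  then have q: "quinv_non_attacking lam \<tau>"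
    using lev_quinv_na_if_lev_quad_na by (simp add: quinv_non_attacking_iff)
  have diag: "\<tau> (Suc r, j) \<noteq> \<tau> (r, k)"
    if "(Suc r, j) \<in> dg lam" "(r, k) \<in> dg lam" "k < j" "ht j = ht k" for r j k
    using that a lev_qnaD[of r \<tau> j k] ht_less_top_level[of j] by (auto simp: dg_iff)
  show "non_attacking lam \<tau>"
    unfolding non_attacking_def using q diag by fastforce
qed

text \<open>The part of the sign sum not attached to a pair of consecutive rows: the top inversions
  and the signs of the bottom row.\<close>

definition topwt :: "(nat \<times> nat \<Rightarrow> nat) \<Rightarrow> int poly poly" where
  "topwt \<tau> = tvar ^ card (top_inv \<tau>) * (tvar - 1) ^ card (cols 0)"

lemma quinv_sign_sum:
  assumes pos: "\<And>z. z \<in> dg lam \<Longrightarrow> 1 \<le> \<tau> z" and q: "quinv_non_attacking lam \<tau>"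
  shows "(\<Sum>\<sigma>\<in>lifts \<tau>. (-1) ^ num_neg lam \<sigma> * qvar ^ maj lam \<sigma> *
      tvar ^ (num_pos lam \<sigma> + quinv lam \<sigma>)) = (\<Prod>r = 1..<top_level. wt_quinv r \<tau>) * topwt \<tau>"
proof -
  have dist: "rowdist \<tau>" and na': "\<forall>r\<in>{1..<top_level}. lev_quinv_na r \<tau>"
    using q by (auto simp: quinv_non_attacking_iff)
  \<comment> \<open>From \<open>top_level\<close> on no column is left and the condition is
    vacuous.\<close>
  have na: "lev_quinv_na r \<tau>" if "1 \<le> r" for r
  proof (cases "r < top_level")
    case False
    then show ?thesis using ht_less_top_level by (fastforce simp: lev_quinv_na_def)
  qed (use that na' in auto)
  have "(\<Prod>r = 1..<top_level. \<Prod>j\<in>cols r.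
        tvar * qvar ^ desc \<tau> r j False * tvar ^ cnt_quinv \<tau> r j False
        - qvar ^ desc \<tau> r j True * tvar ^ cnt_quinv \<tau> r j True) = (\<Prod>r = 1..<top_level. wt_quinv r \<tau>)"
    unfolding wt_quinv_def using na colfac_as_sign_sum[OF dist] by (intro prod.cong) auto
  moreover have "quinv lam \<sigma> = card (top_inv \<tau>) +
      (\<Sum>r = 1..<top_level. \<Sum>j\<in>cols r. cnt_quinv \<tau> r j (is_neg (\<sigma> (Suc r, j))))"
    if "\<sigma> \<in> lifts \<tau>" for \<sigma>
    by (rule quinv_lifts[OF that pos dist na])
  note sign_sum[where stat = "quinv lam" and n = "card (top_inv \<tau>)" and c = "cnt_quinv \<tau>", OF pos this]
  ultimately show ?thesis by (simp add: topwt_def mult.commute)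
qed

lemma quadcoinv_sign_sum:
  assumes pos: "\<And>z. z \<in> dg lam \<Longrightarrow> 1 \<le> \<tau> z" and q: "non_attacking lam \<tau>"
  shows "(\<Sum>\<sigma>\<in>lifts \<tau>. (-1) ^ num_neg lam \<sigma> * qvar ^ maj lam \<sigma> *
      tvar ^ (num_pos lam \<sigma> + quadcoinv lam \<sigma>)) = (\<Prod>r = 1..<top_level. wt_quad r \<tau>) * topwt \<tau>"
proof -
  have dist: "rowdist \<tau>" and na': "\<forall>r\<in>{1..<top_level}. lev_quad_na r \<tau>"
    using q by (auto simp: non_attacking_iff)
  have na: "lev_quad_na r \<tau>" if "1 \<le> r" for r
  proof (cases "r < top_level")
    case False
    then show ?thesis using ht_less_top_level by (fastforce simp: lev_quad_na_def)
  qed (use that na' in auto)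
  have "(\<Prod>r = 1..<top_level. \<Prod>j\<in>cols r.
        tvar * qvar ^ desc \<tau> r j False * tvar ^ cnt_quad \<tau> r j False
        - qvar ^ desc \<tau> r j True * tvar ^ cnt_quad \<tau> r j True) = (\<Prod>r = 1..<top_level. wt_quad r \<tau>)"
    unfolding wt_quad_def using na by (intro prod.cong) (auto simp: fac_quad_as_sign_sum)
  moreover have "quadcoinv lam \<sigma> = card (top_inv \<tau>) +
      (\<Sum>r = 1..<top_level. \<Sum>j\<in>cols r. cnt_quad \<tau> r j (is_neg (\<sigma> (Suc r, j))))"
    if "\<sigma> \<in> lifts \<tau>" for \<sigma>
    by (rule quadcoinv_lifts[OF that pos dist na])
  note sign_sum[where stat = "quadcoinv lam" and n = "card (top_inv \<tau>)" and c = "cnt_quad \<tau>", OF pos this]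
  ultimately show ?thesis by (simp add: topwt_def mult.commute)
qed

section \<open>Fillings with a fixed monomial\<close>

definition fillings :: "monomial \<Rightarrow> (nat \<times> nat \<Rightarrow> nat) set" where
  "fillings \<mu> = {\<tau> \<in> dg lam \<rightarrow>\<^sub>E {1..}. xmonom lam \<tau> = \<mu> \<and> rowdist \<tau>}"

lemma finite_fillings: "finite (fillings \<mu>)"
proof (rule finite_subset)
  show "fillings \<mu> \<subseteq> dg lam \<rightarrow>\<^sub>E set_mset \<mu>"
    by (auto simp: fillings_def xmonom_def finite_dg PiE_def extensional_def)
qed (simp add: finite_PiE finite_dg)

text \<open>A swap permutes the boxes of one row, which keeps the content and the distinctness in
  rows. It may create attacks between rows; \<open>fillings\<close> permits these, and the weights
  then vanish.\<close>

lemma sw_fillings: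
  assumes "1 \<le> r" "adm r i" "\<tau> \<in> fillings \<mu>"
  shows "sw r i \<tau> \<in> fillings \<mu>"
proof -
  let ?p = "transpose (r, i) (r, Suc i)"
  have i: "1 \<le> i" "ht i = ht (Suc i)" "r \<le> ht i" using assms by (auto simp: adm_def)
  have mem: "?p z \<in> dg lam \<longleftrightarrow> z \<in> dg lam" for z
    using assms(1) i by (cases z) (auto simp: transpose_def dg_iff)
  have im: "?p ` dg lam = dg lam"
    using mem by (force simp: image_iff intro: bexI[of _ "?p _"])
  have \<tau>: "\<tau> \<in> dg lam \<rightarrow>\<^sub>E {1..}" "xmonom lam \<tau> = \<mu>" "rowdist \<tau>"
    using assms(3) by (auto simp: fillings_def)
  have "sw r i \<tau> \<in> dg lam \<rightarrow>\<^sub>E {1..}"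
    unfolding PiE_iff extensional_def sw_def comp_def mem_Collect_eq
    using \<tau>(1) mem by (metis (no_types, lifting) PiE_E)
  moreover have "xmonom lam (sw r i \<tau>) = \<mu>"
  proof -
    have "xmonom lam (sw r i \<tau>) = image_mset \<tau> (image_mset ?p (mset_set (dg lam)))"
      by (simp add: xmonom_def sw_def multiset.map_comp)
    also have "image_mset ?p (mset_set (dg lam)) = mset_set (dg lam)"
      by (subst image_mset_mset_set) (auto simp: im intro: inj_on_subset[OF inj_transpose])
    finally show ?thesis using \<tau>(2) by (simp add: xmonom_def)
  qed
  moreover have "rowdist (sw r i \<tau>)"
    unfolding rowdist_def
  proof (intro allI impI)
    fix s j k
    assume a: "1 \<le> s \<and> 1 \<le> j \<and> 1 \<le> k \<and> s \<le> ht j \<and> s \<le> ht k \<and> sw r i \<tau> (s, j) = sw r i \<tau> (s, k)"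
    show "j = k"
    proof (cases "s = r")
      case True
      let ?q = "transpose i (Suc i)"
      have "1 \<le> ?q j" "1 \<le> ?q k" using a i by (auto simp: transpose_def)
      then have "?q j = ?q k"
        using rowdistD[OF \<tau>(3), of r "?q j" "?q k"] a True i by (simp add: sw_apply ht_transpose)
      then show ?thesis by (metis transpose_involutory)
    next
      case False
      then show ?thesis using rowdistD[OF \<tau>(3), of s j k] a by (simp add: sw_apply)
    qed
  qed
  ultimately show ?thesis by (simp add: fillings_def)
qed

text \<open>The swapped columns continue above row \<open>r\<close>, so no top box of a column is
  moved.\<close>

lemma top_inv_sw:
  assumes "adm (Suc r) i"
  shows "top_inv (sw r i \<tau>) = top_inv \<tau>"
proof -
  have i: "ht i = ht (Suc i)" "r < ht i" using assms by (auto simp: adm_def)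
  have "sw r i \<tau> (s, j) = \<tau> (s, j)" if "ht j = s" for s j
    using that i by (auto simp: sw_apply transpose_def)
  then have "sw r i \<tau> (s, j) < sw r i \<tau> (s, k) \<longleftrightarrow> \<tau> (s, j) < \<tau> (s, k)"
    if "ht j = s" "ht k = s" for s j k
    using that by metis
  then show ?thesis unfolding top_inv_def by blast
qed

text \<open>Super fillings are grouped by their absolute values, and the sets of lifts of different
  fillings are disjoint.\<close>

lemma series_coeff_by_lifts:
  fixes wt :: "(nat \<times> nat \<Rightarrow> letter) \<Rightarrow> int poly poly"
  assumes P: "\<And>\<tau> \<tau>'. (\<And>z. z \<in> dg lam \<Longrightarrow> \<tau> z = \<tau>' z) \<Longrightarrow> P \<tau> \<longleftrightarrow> P \<tau>'"
    and dist: "\<And>\<tau>. P \<tau> \<Longrightarrow> rowdist \<tau>"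
  shows "series_sum {\<sigma> \<in> super_fillings lam. P (abs_filling \<sigma>)} wt
      (\<lambda>\<sigma>. xmonom lam (abs_filling \<sigma>)) \<mu> = (\<Sum>\<tau>\<in>{\<tau> \<in> fillings \<mu>. P \<tau>}. \<Sum>\<sigma>\<in>lifts \<tau>. wt \<sigma>)"
proof -
  have xm: "xmonom lam \<tau> = xmonom lam \<tau>'" if "\<And>z. z \<in> dg lam \<Longrightarrow> \<tau> z = \<tau>' z" for \<tau> \<tau>'
    unfolding xmonom_def using that by (intro image_mset_cong) (simp add: finite_dg)
  have lifts: "\<sigma> \<in> lifts \<tau> \<longleftrightarrow> \<sigma> \<in> extensional (dg lam) \<and> (\<forall>z\<in>dg lam. labs (\<sigma> z) = \<tau> z)" for \<sigma> \<tau>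
  proof -
    have "x \<in> {Pos n, Neg n} \<longleftrightarrow> labs x = n" for x n by (cases x) auto
    then show ?thesis by (auto simp: lifts_def PiE_def Pi_def)
  qed
  have "{\<sigma>. \<sigma> \<in> {\<sigma> \<in> super_fillings lam. P (abs_filling \<sigma>)} \<and> xmonom lam (abs_filling \<sigma>) = \<mu>} =
      (\<Union>\<tau>\<in>{\<tau> \<in> fillings \<mu>. P \<tau>}. lifts \<tau>)" (is "?L = ?R")
  proof (rule set_eqI)
    fix \<sigma>
    have pos: "\<sigma> \<in> super_fillings lam \<longleftrightarrow>
        \<sigma> \<in> extensional (dg lam) \<and> (\<forall>z\<in>dg lam. 1 \<le> labs (\<sigma> z))"
      by (auto simp: super_fillings_def PiE_def Pi_def alphabet_def)
    show "\<sigma> \<in> ?L \<longleftrightarrow> \<sigma> \<in> ?R"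
    proof
      assume L: "\<sigma> \<in> ?L"
      \<comment> \<open>Outside the diagram \<open>abs_filling\<close> need not be
        \<open>undefined\<close>, so it is restricted to become extensional.\<close>
      let ?t = "restrict (abs_filling \<sigma>) (dg lam)"
      have "P ?t" using L P[of ?t "abs_filling \<sigma>"] by simp
      moreover have "xmonom lam ?t = \<mu>" using L xm[of ?t "abs_filling \<sigma>"] by simp
      moreover have "?t \<in> dg lam \<rightarrow>\<^sub>E {1..}" using L pos by (auto simp: abs_filling_def)
      moreover have "\<sigma> \<in> lifts ?t" using L pos by (simp add: lifts abs_filling_def)
      ultimately have "?t \<in> {\<tau> \<in> fillings \<mu>. P \<tau>}" "\<sigma> \<in> lifts ?t"
        using dist by (simp_all add: fillings_def)
      then show "\<sigma> \<in> ?R" by blast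
    next
      assume "\<sigma> \<in> ?R"
      then obtain \<tau> where t: "\<tau> \<in> fillings \<mu>" "P \<tau>" "\<sigma> \<in> lifts \<tau>" by auto
      have eq: "abs_filling \<sigma> z = \<tau> z" if "z \<in> dg lam" for z
        using t(3) that by (simp add: lifts abs_filling_def)
      have "1 \<le> \<tau> z" if "z \<in> dg lam" for z using t(1) that by (auto simp: fillings_def)
      then have "\<sigma> \<in> super_fillings lam" using t(3) by (simp add: pos lifts)
      then show "\<sigma> \<in> ?L" using P[of "abs_filling \<sigma>" \<tau>] xm[of "abs_filling \<sigma>" \<tau>] eq t
        by (simp add: fillings_def)
    qed
  qed
  moreover have "\<tau> = \<tau>'" if "\<tau> \<in> fillings \<mu>" "\<tau>' \<in> fillings \<mu>" "\<sigma> \<in> lifts \<tau>" "\<sigma> \<in> lifts \<tau>'" for \<tau> \<tau>' \<sigma>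
  proof (rule PiE_ext)
    show "\<tau> \<in> dg lam \<rightarrow>\<^sub>E {1..}" "\<tau>' \<in> dg lam \<rightarrow>\<^sub>E {1..}"
      using that(1,2) by (simp_all add: fillings_def)
    fix z assume "z \<in> dg lam"
    then show "\<tau> z = \<tau>' z" using that(3,4) by (simp add: lifts)
  qed
  ultimately show ?thesis
    unfolding series_sum_def
    by (simp only:) (rule sum.UNION_disjoint; auto simp: finite_fillings lifts_def finite_dg intro!: finite_PiE)
qed

end

section \<open>Coefficientwise comparison of the two series\<close>

theorem theorem1p4:
  fixes lam :: "nat list"
  assumes "is_partition lam"
  shows "series_sum {\<sigma> \<in> super_fillings lam. non_attacking lam (abs_filling \<sigma>)}
           (\<lambda>\<sigma>. (-1) ^ num_neg lam \<sigma> * qvar ^ maj lam \<sigma> * tvar ^ (num_pos lam \<sigma> + quadcoinv lam \<sigma>))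
           (\<lambda>\<sigma>. xmonom lam (abs_filling \<sigma>))
       = series_sum {\<sigma> \<in> super_fillings lam. quinv_non_attacking lam (abs_filling \<sigma>)}
           (\<lambda>\<sigma>. (-1) ^ num_neg lam \<sigma> * qvar ^ maj lam \<sigma> * tvar ^ (num_pos lam \<sigma> + quinv lam \<sigma>))
           (\<lambda>\<sigma>. xmonom lam (abs_filling \<sigma>))"
    (is "series_sum ?SB ?wB ?x = series_sum ?SA ?wA ?x")
proof (rule ext)
  fix \<mu>
  let ?F = "fillings lam \<mu>" and ?M = "top_level lam"
  have cong: "quinv_non_attacking lam \<tau> \<longleftrightarrow> quinv_non_attacking lam \<tau>'"
    "non_attacking lam \<tau> \<longleftrightarrow> non_attacking lam \<tau>'"
    if "\<And>z. z \<in> dg lam \<Longrightarrow> \<tau> z = \<tau>' z" for \<tau> \<tau>'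
    using that by (simp_all add: non_attacking_def quinv_non_attacking_def cong: bex_cong)
  have rowdistA: "quinv_non_attacking lam \<tau> \<Longrightarrow> rowdist lam \<tau>"
    and rowdistB: "non_attacking lam \<tau> \<Longrightarrow> rowdist lam \<tau>" for \<tau>
    by (simp_all add: quinv_non_attacking_iff non_attacking_iff)
  have coeffA: "series_sum ?SA wt ?x \<mu> =
      (\<Sum>\<tau>\<in>{\<tau> \<in> ?F. quinv_non_attacking lam \<tau>}. \<Sum>\<sigma>\<in>lifts lam \<tau>. wt \<sigma>)"
    for wt :: "_ \<Rightarrow> int poly poly"
    by (rule series_coeff_by_lifts) (rule cong(1), simp, erule rowdistA)
  have coeffB: "series_sum ?SB wt ?x \<mu> =
      (\<Sum>\<tau>\<in>{\<tau> \<in> ?F. non_attacking lam \<tau>}. \<Sum>\<sigma>\<in>lifts lam \<tau>. wt \<sigma>)"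
    for wt :: "_ \<Rightarrow> int poly poly"
    by (rule series_coeff_by_lifts) (rule cong(2), simp, erule rowdistB)
  have pos: "1 \<le> \<tau> z" if "\<tau> \<in> ?F" "z \<in> dg lam" for \<tau> z
    using that by (auto simp: fillings_def)
  have dist: "rowdist lam \<tau>" if "\<tau> \<in> ?F" for \<tau>
    using that by (simp add: fillings_def)
  have "series_sum ?SB ?wB ?x \<mu> =
      (\<Sum>\<tau>\<in>{\<tau> \<in> ?F. non_attacking lam \<tau>}. (\<Prod>r = 1..<?M. wt_quad lam r \<tau>) * topwt lam \<tau>)"
    unfolding coeffB
    by (intro sum.cong refl quadcoinv_sign_sum) (use pos in auto)
  \<comment> \<open>A filling in \<open>?F\<close> that is not non-attacking has a pair of rows of
    weight 0, so the sum extends to all of \<open>?F\<close>.\<close>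
  also have "\<dots> = sum_quad lam ?F ?M (topwt lam)"
    unfolding sum_quad_def
    by (rule sum.mono_neutral_left)
      (auto simp: finite_fillings wt_quad_def non_attacking_iff dist)
  \<comment> \<open>\<open>topwt\<close> is an admissible test function because
    \<open>top_inv\<close> is unchanged by swaps below the tops of the columns.\<close>
  also have "\<dots> = sum_quinv lam ?F ?M (topwt lam)"
    by (rule sum_quinv_eq_sum_quad[symmetric])
      (auto simp: finite_fillings sw_fillings dist symbelow_def topwt_def top_inv_sw top_level_def)
  also have "\<dots> =
      (\<Sum>\<tau>\<in>{\<tau> \<in> ?F. quinv_non_attacking lam \<tau>}. (\<Prod>r = 1..<?M. wt_quinv lam r \<tau>) * topwt lam \<tau>)"
    unfolding sum_quinv_def
    by (rule sum.mono_neutral_right)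
      (auto simp: finite_fillings wt_quinv_def quinv_non_attacking_iff dist)
  also have "\<dots> = series_sum ?SA ?wA ?x \<mu>"
    unfolding coeffA
    by (intro sum.cong refl quinv_sign_sum[symmetric]) (use pos in auto)
  finally show "series_sum ?SB ?wB ?x \<mu> = series_sum ?SA ?wA ?x \<mu>" .
qed

end
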